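(* Let $F$ be a field of positive characteristic, let $D\subseteq A$ be domains of finite type over $F$ and suppose that $D$ is one-dimensional. Let $I$ be an ideal of $A$ and $f\in A$. Put $S=D\setminus\{0\}$. Suppose that $f\in (S^{-1}I)^*$ in the generic fiber ring $S^{-1}A$. Assume that tight closure commutes with localization, i.e. that $(S^{-1}I)^*=S^{-1}(I^* )$. Then, for all but finitely many maximal ideals $\mathfrak{m}$ of $D$, the image of $f$ belongs to the tight closure of the extended ideal of $I$ in the fiber ring $A\otimes_D D/\mathfrak{m}$.
   Context: For a commutative noetherian ring $R$ containing a field of characteristic $p>0$ and an ideal $J\subseteq R$, the tight closure $J^*$ is the set of $f\in R$ for which there exists $c\in R$, not contained in any minimal prime of $R$ (so $c\neq0$ when $R$ is a domain), with $cf^q\in J^{[q]}$ for all sufficiently large $q=p^e$ (when $R$ is a domain one may equivalently require this for all $q=p^e$, $e\ge 0$), where $J^{[q]}$ is the ideal generated by all $q$-th powers of elements of $J$. *)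

theory Defs
  imports "HOL-Algebra.Generated_Rings" "HOL-Algebra.QuotRing" "HOL-Library.Extended_Nat" "HOL-Library.Poly_Mapping"
begin

section \<open>Rings: characteristic, finite type, Krull dimension, minimal primes\<close>

text \<open>The non-negative generator of \<open>{n. n \<cdot> 1 = 0}\<close>; it is \<open>0\<close> in characteristic zero.\<close>

definition ring_char :: "('a, 'm) ring_scheme \<Rightarrow> nat" where
  "ring_char R = Gcd {n :: nat. add_pow R n \<one>\<^bsub>R\<^esub> = \<zero>\<^bsub>R\<^esub>}"

text \<open>For \<open>K\<close> a subring of \<open>R\<close>: \<open>R\<close> is generated over \<open>K\<close> by finitely many elements.\<close>

definition finite_type :: "('a, 'm) ring_scheme \<Rightarrow> 'a set \<Rightarrow> bool" where
  "finite_type R K \<longleftrightarrow>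
     (\<exists>T. finite T \<and> T \<subseteq> carrier R \<and> generate_ring R (K \<union> T) = carrier R)"

text \<open>Supremum of the lengths \<open>n\<close> of strict chains \<open>P 0 \<subset> \<dots> \<subset> P n\<close> of prime ideals
  (for the zero ring this gives \<open>0\<close>).\<close>

definition krull_dim :: "('a, 'm) ring_scheme \<Rightarrow> enat" where
  "krull_dim R =
     (SUP n \<in> {n. \<exists>P :: nat \<Rightarrow> 'a set.
                    (\<forall>i\<le>n. primeideal (P i) R) \<and> (\<forall>i<n. P i \<subset> P (Suc i))}. enat n)"

definition minimal_prime :: "'a set \<Rightarrow> ('a, 'm) ring_scheme \<Rightarrow> bool" where
  "minimal_prime P R \<longleftrightarrow> primeideal P R \<and> (\<forall>Q. primeideal Q R \<and> Q \<subseteq> P \<longrightarrow> Q = P)"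


section \<open>Tight closure\<close>

definition frobenius_power :: "('a, 'm) ring_scheme \<Rightarrow> 'a set \<Rightarrow> nat \<Rightarrow> 'a set" where
  "frobenius_power R J q = genideal R {x [^]\<^bsub>R\<^esub> q | x. x \<in> J}"

text \<open>Here \<open>p\<close> is the characteristic of a field contained in \<open>R\<close>. It is a parameter, not
  \<open>ring_char R\<close>, because fiber rings may be zero.\<close>

definition tight_closure :: "nat \<Rightarrow> ('a, 'm) ring_scheme \<Rightarrow> 'a set \<Rightarrow> 'a set" where
  "tight_closure p R J =
     {f \<in> carrier R. \<exists>c \<in> carrier R. (\<forall>P. minimal_prime P R \<longrightarrow> c \<notin> P) \<and>
        (\<exists>e0. \<forall>e\<ge>e0. c \<otimes>\<^bsub>R\<^esub> f [^]\<^bsub>R\<^esub> (p ^ e) \<in> frobenius_power R J (p ^ e))}"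


section \<open>Localization\<close>

definition loc_rel :: "('a, 'm) ring_scheme \<Rightarrow> 'a set \<Rightarrow> (('a \<times> 'a) \<times> ('a \<times> 'a)) set" where
  "loc_rel R S =
     {((r, s), (r', s')). r \<in> carrier R \<and> s \<in> S \<and> r' \<in> carrier R \<and> s' \<in> S \<and>
        (\<exists>t\<in>S. t \<otimes>\<^bsub>R\<^esub> (s' \<otimes>\<^bsub>R\<^esub> r) = t \<otimes>\<^bsub>R\<^esub> (s \<otimes>\<^bsub>R\<^esub> r'))}"

text \<open>The fraction \<open>r/s\<close>.\<close>

definition loc_frac :: "('a, 'm) ring_scheme \<Rightarrow> 'a set \<Rightarrow> 'a \<Rightarrow> 'a \<Rightarrow> ('a \<times> 'a) set" where
  "loc_frac R S r s = loc_rel R S `` {(r, s)}"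

text \<open>The ring \<open>S\<inverse>R\<close> for a multiplicative subset \<open>S\<close>; the operations act on
  representatives, and each union below is over a family of equal classes.\<close>

definition localization :: "('a, 'm) ring_scheme \<Rightarrow> 'a set \<Rightarrow> ('a \<times> 'a) set ring" where
  "localization R S =
     \<lparr>carrier = (carrier R \<times> S) // loc_rel R S,
      mult = (\<lambda>U V. \<Union>x\<in>U. \<Union>y\<in>V.
                loc_frac R S (fst x \<otimes>\<^bsub>R\<^esub> fst y) (snd x \<otimes>\<^bsub>R\<^esub> snd y)),
      one = loc_frac R S \<one>\<^bsub>R\<^esub> \<one>\<^bsub>R\<^esub>,
      zero = loc_frac R S \<zero>\<^bsub>R\<^esub> \<one>\<^bsub>R\<^esub>,
      add = (\<lambda>U V. \<Union>x\<in>U. \<Union>y\<in>V.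
               loc_frac R S ((snd y \<otimes>\<^bsub>R\<^esub> fst x) \<oplus>\<^bsub>R\<^esub> (snd x \<otimes>\<^bsub>R\<^esub> fst y))
                 (snd x \<otimes>\<^bsub>R\<^esub> snd y))\<rparr>"

text \<open>\<open>S\<inverse>I\<close> as an ideal of \<open>S\<inverse>R\<close>.\<close>

definition loc_ideal :: "('a, 'm) ring_scheme \<Rightarrow> 'a set \<Rightarrow> 'a set \<Rightarrow> ('a \<times> 'a) set set" where
  "loc_ideal R S I = {loc_frac R S i s | i s. i \<in> I \<and> s \<in> S}"


section \<open>Tensor product of algebras\<close>

text \<open>For commutative rings \<open>R\<close>, \<open>T\<close> and ring homomorphisms \<open>\<alpha> : K \<rightarrow> R\<close>, \<open>\<beta> : K \<rightarrow> T\<close>,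
  the ring \<open>R \<otimes>\<^sub>K T\<close> is the free abelian group on \<open>R \<times> T\<close>, with
  \<open>(r, t) (r', t') = (r r', t t')\<close> extended bilinearly, modulo the usual bilinearity relations.
  The subgroup these generate is already an ideal.\<close>

definition free_pair_ring ::
  "('a, 'm) ring_scheme \<Rightarrow> ('b, 'n) ring_scheme \<Rightarrow> (('a \<times> 'b) \<Rightarrow>\<^sub>0 int) ring" where
  "free_pair_ring R T =
     \<lparr>carrier = {x. Poly_Mapping.keys x \<subseteq> carrier R \<times> carrier T},
      mult = (\<lambda>x y. frag_extend (\<lambda>(r, t). frag_extend (\<lambda>(r', t').
                frag_of (r \<otimes>\<^bsub>R\<^esub> r', t \<otimes>\<^bsub>T\<^esub> t')) y) x),
      one = frag_of (\<one>\<^bsub>R\<^esub>, \<one>\<^bsub>T\<^esub>),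
      zero = 0,
      add = (+)\<rparr>"

definition tensor_relations ::
  "('k, 'l) ring_scheme \<Rightarrow> ('a, 'm) ring_scheme \<Rightarrow> ('k \<Rightarrow> 'a) \<Rightarrow>
   ('b, 'n) ring_scheme \<Rightarrow> ('k \<Rightarrow> 'b) \<Rightarrow> (('a \<times> 'b) \<Rightarrow>\<^sub>0 int) set" where
  "tensor_relations K R \<alpha> T \<beta> =
     {frag_of (r \<oplus>\<^bsub>R\<^esub> r', t) - frag_of (r, t) - frag_of (r', t) | r r' t.
        r \<in> carrier R \<and> r' \<in> carrier R \<and> t \<in> carrier T} \<union>
     {frag_of (r, t \<oplus>\<^bsub>T\<^esub> t') - frag_of (r, t) - frag_of (r, t') | r t t'.
        r \<in> carrier R \<and> t \<in> carrier T \<and> t' \<in> carrier T} \<union>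
     {frag_of (\<alpha> k \<otimes>\<^bsub>R\<^esub> r, t) - frag_of (r, \<beta> k \<otimes>\<^bsub>T\<^esub> t) | k r t.
        k \<in> carrier K \<and> r \<in> carrier R \<and> t \<in> carrier T}"

definition tensor_ideal ::
  "('k, 'l) ring_scheme \<Rightarrow> ('a, 'm) ring_scheme \<Rightarrow> ('k \<Rightarrow> 'a) \<Rightarrow>
   ('b, 'n) ring_scheme \<Rightarrow> ('k \<Rightarrow> 'b) \<Rightarrow> (('a \<times> 'b) \<Rightarrow>\<^sub>0 int) set" where
  "tensor_ideal K R \<alpha> T \<beta> = genideal (free_pair_ring R T) (tensor_relations K R \<alpha> T \<beta>)"

definition tensor_ring ::
  "('k, 'l) ring_scheme \<Rightarrow> ('a, 'm) ring_scheme \<Rightarrow> ('k \<Rightarrow> 'a) \<Rightarrow>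
   ('b, 'n) ring_scheme \<Rightarrow> ('k \<Rightarrow> 'b) \<Rightarrow> (('a \<times> 'b) \<Rightarrow>\<^sub>0 int) set ring" where
  "tensor_ring K R \<alpha> T \<beta> = free_pair_ring R T Quot tensor_ideal K R \<alpha> T \<beta>"

definition pure_tensor ::
  "('k, 'l) ring_scheme \<Rightarrow> ('a, 'm) ring_scheme \<Rightarrow> ('k \<Rightarrow> 'a) \<Rightarrow>
   ('b, 'n) ring_scheme \<Rightarrow> ('k \<Rightarrow> 'b) \<Rightarrow> 'a \<Rightarrow> 'b \<Rightarrow> (('a \<times> 'b) \<Rightarrow>\<^sub>0 int) set" where
  "pure_tensor K R \<alpha> T \<beta> r t = tensor_ideal K R \<alpha> T \<beta> +>\<^bsub>free_pair_ring R T\<^esub> frag_of (r, t)"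


section \<open>Fibers over a subring\<close>

text \<open>\<open>D\<close> is (the carrier of) a subring of \<open>A\<close>.\<close>

abbreviation subring_of :: "('a, 'm) ring_scheme \<Rightarrow> 'a set \<Rightarrow> ('a, 'm) ring_scheme" where
  "subring_of A D \<equiv> A\<lparr>carrier := D\<rparr>"

text \<open>\<open>A \<otimes>\<^sub>D D/\<mm>\<close>, and \<open>a \<mapsto> a \<otimes> 1\<close> from \<open>A\<close> to it.\<close>

definition fiber_ring ::
  "('a, 'm) ring_scheme \<Rightarrow> 'a set \<Rightarrow> 'a set \<Rightarrow> (('a \<times> 'a set) \<Rightarrow>\<^sub>0 int) set ring" where
  "fiber_ring A D \<mm> =
     tensor_ring (subring_of A D) A (\<lambda>d. d)
       (subring_of A D Quot \<mm>) (\<lambda>d. \<mm> +>\<^bsub>subring_of A D\<^esub> d)"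

definition fiber_map ::
  "('a, 'm) ring_scheme \<Rightarrow> 'a set \<Rightarrow> 'a set \<Rightarrow> 'a \<Rightarrow> (('a \<times> 'a set) \<Rightarrow>\<^sub>0 int) set" where
  "fiber_map A D \<mm> a =
     pure_tensor (subring_of A D) A (\<lambda>d. d)
       (subring_of A D Quot \<mm>) (\<lambda>d. \<mm> +>\<^bsub>subring_of A D\<^esub> d)
       a \<one>\<^bsub>subring_of A D Quot \<mm>\<^esub>"

definition extended_ideal :: "('b, 'n) ring_scheme \<Rightarrow> ('a \<Rightarrow> 'b) \<Rightarrow> 'a set \<Rightarrow> 'b set" where
  "extended_ideal B \<phi> I = genideal B (\<phi> ` I)"

end

theory Submission
  imports Defs "HOL-Algebra.Ring_Divisibility" "HOL-Algebra.Free_Abelian_Groups"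
begin

text \<open>Clearing denominators gives \<open>s \<in> D - {0}\<close> and \<open>c \<noteq> 0\<close> with \<open>c (s f)\<^sup>q \<in> I\<^sup>[\<^sup>q\<^sup>]\<close> for large \<open>q\<close>.
  Outside finitely many \<open>\<mm>\<close> the image of \<open>s\<close> in the fiber is a unit, so the image of \<open>c\<close> is a
  witness there as soon as it lies in no minimal prime of the fiber.

  This holds generically for the following reason, which avoids dimension theory on \<open>A\<close>. As \<open>A\<close> is
  noetherian, a single \<open>d \<in> D - {0}\<close> kills the \<open>D\<close>-torsion of \<open>A/cA\<close>. If \<open>d \<notin> \<mm>\<close>, write
  \<open>1 = u \<pi> + r d\<close> with \<open>0 \<noteq> \<pi> \<in> \<mm>\<close>; then \<open>c\<close> is a nonzerodivisor modulo \<open>\<pi>A\<close>. Hence below any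
  prime \<open>Q \<supseteq> \<mm>A\<close> there is a prime \<open>P \<ni> \<pi>\<close> with \<open>c \<notin> P\<close>. The contraction of \<open>P\<close> to \<open>D\<close> is a nonzero
  prime contained in \<open>\<mm>\<close>, so it equals \<open>\<mm>\<close> because \<open>D\<close> is one-dimensional; thus \<open>P \<supseteq> \<mm>A\<close>, and
  if \<open>Q\<close> comes from a minimal prime of the fiber, then \<open>P = Q\<close>.\<close>

section \<open>The Hilbert basis theorem for rings of finite type\<close>

context cring
begin

text \<open>These are the values at \<open>x\<close> of the polynomials over \<open>K\<close> of
  degree strictly below \<open>n\<close>. Working with values inside the ring treats algebraic and
  transcendental \<open>x\<close> alike.\<close>

primrec truncated_span :: "'a set \<Rightarrow> 'a \<Rightarrow> nat \<Rightarrow> 'a set" where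
  "truncated_span K x 0 = {\<zero>}"
| "truncated_span K x (Suc n) = {y \<oplus> k \<otimes> x [^] n | y k. y \<in> truncated_span K x n \<and> k \<in> K}"

text \<open>Since \<open>x\<close> may be algebraic over \<open>K\<close>, an element of \<open>K[x]\<close> has no well-defined degree;
  these are the leading coefficients of all formal representations of degree \<open>n\<close> of the
  elements of \<open>J\<close>.\<close>

definition leading_coeffs :: "'a set \<Rightarrow> 'a \<Rightarrow> 'a set \<Rightarrow> nat \<Rightarrow> 'a set" where
  "leading_coeffs K x J n = {k \<in> K. \<exists>y \<in> truncated_span K x n. y \<oplus> k \<otimes> x [^] n \<in> J}"

section \<open>Coefficient ideals and the one-generator step of the basis theorem\<close>

context
  fixes K :: "'a set" and x :: 'a
  assumes K: "subring K R" and x: "x \<in> carrier R"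
begin

lemma coeff_carrier: "k \<in> K \<Longrightarrow> k \<in> carrier R"
  using subringE(1)[OF K] by blast

lemma truncated_span_carrier: "y \<in> truncated_span K x n \<Longrightarrow> y \<in> carrier R"
  using x coeff_carrier by (induction n arbitrary: y) auto

lemma truncated_span_Suc_I:
  "y \<in> truncated_span K x n \<Longrightarrow> k \<in> K \<Longrightarrow> y \<oplus> k \<otimes> x [^] n \<in> truncated_span K x (Suc n)"
  by auto

lemma truncated_span_zero: "\<zero> \<in> truncated_span K x n"
proof (induction n)
  case (Suc n)
  have "\<zero> = \<zero> \<oplus> \<zero> \<otimes> x [^] n"
    using x by simp
  then show ?case
    using truncated_span_Suc_I[OF Suc subringE(2)[OF K]] by simp
qed simp

lemma truncated_span_mono: "truncated_span K x n \<subseteq> truncated_span K x (Suc n)"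
proof
  fix y assume y: "y \<in> truncated_span K x n"
  have "y = y \<oplus> \<zero> \<otimes> x [^] n"
    using x truncated_span_carrier[OF y] by simp
  then show "y \<in> truncated_span K x (Suc n)"
    using truncated_span_Suc_I[OF y subringE(2)[OF K]] by simp
qed

lemma truncated_span_mono_le: "m \<le> n \<Longrightarrow> truncated_span K x m \<subseteq> truncated_span K x n"
  by (rule lift_Suc_mono_le[of "truncated_span K x"]) (rule truncated_span_mono)

lemma truncated_span_add:
  "y \<in> truncated_span K x n \<Longrightarrow> z \<in> truncated_span K x n \<Longrightarrow> y \<oplus> z \<in> truncated_span K x n"
proof (induction n arbitrary: y z)
  case (Suc n)
  from Suc.prems obtain y' k z' l where *: "y = y' \<oplus> k \<otimes> x [^] n" "z = z' \<oplus> l \<otimes> x [^] n"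
      "y' \<in> truncated_span K x n" "z' \<in> truncated_span K x n" "k \<in> K" "l \<in> K"
    by auto
  note c = truncated_span_carrier[OF *(3)] truncated_span_carrier[OF *(4)]
    coeff_carrier[OF *(5)] coeff_carrier[OF *(6)] nat_pow_closed[OF x, of n]
  have "y \<oplus> z = (y' \<oplus> z') \<oplus> (k \<oplus> l) \<otimes> x [^] n"
    unfolding * using c by algebra
  then show ?case
    using truncated_span_Suc_I[OF Suc.IH[OF *(3,4)] subringE(7)[OF K *(5,6)]] by metis
qed simp

lemma truncated_span_smult:
  "y \<in> truncated_span K x n \<Longrightarrow> a \<in> K \<Longrightarrow> a \<otimes> y \<in> truncated_span K x n"
proof (induction n arbitrary: y)
  case (Suc n)
  from Suc.prems obtain y' k where *: "y = y' \<oplus> k \<otimes> x [^] n"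
      "y' \<in> truncated_span K x n" "k \<in> K"
    by auto
  note c = truncated_span_carrier[OF *(2)] coeff_carrier[OF *(3)] coeff_carrier[OF Suc.prems(2)]
    nat_pow_closed[OF x, of n]
  have "a \<otimes> y = (a \<otimes> y') \<oplus> (a \<otimes> k) \<otimes> x [^] n"
    unfolding * using c by algebra
  then show ?case
    using truncated_span_Suc_I[OF Suc.IH[OF *(2) Suc.prems(2)] subringE(6)[OF K Suc.prems(2) *(3)]]
    by metis
qed (simp add: coeff_carrier)

lemma truncated_span_a_inv:
  assumes "y \<in> truncated_span K x n" shows "\<ominus> y \<in> truncated_span K x n"
  using truncated_span_smult[OF assms subringE(5)[OF K subringE(3)[OF K]]]
    truncated_span_carrier[OF assms] l_minus[of \<one> y] by simp

lemma truncated_span_shift: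
  "y \<in> truncated_span K x n \<Longrightarrow> x \<otimes> y \<in> truncated_span K x (Suc n)"
proof (induction n arbitrary: y)
  case 0
  then show ?case
    using x truncated_span_zero[of 1] by simp
next
  case (Suc n)
  from Suc.prems obtain y' k where *: "y = y' \<oplus> k \<otimes> x [^] n"
      "y' \<in> truncated_span K x n" "k \<in> K"
    by auto
  note c = truncated_span_carrier[OF *(2)] coeff_carrier[OF *(3)] nat_pow_closed[OF x, of n]
  have "x \<otimes> y = (x \<otimes> y') \<oplus> k \<otimes> (x [^] n \<otimes> x)"
    unfolding * using c x by algebra
  then have "x \<otimes> y = (x \<otimes> y') \<oplus> k \<otimes> x [^] Suc n"
    by simp
  then show ?case
    using truncated_span_Suc_I[OF Suc.IH[OF *(2)] *(3)] by metis
qed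

text \<open>Representations of the same formal degree \<open>n\<close> add coefficientwise, and a
  scalar from \<open>K\<close> multiplies the tail and the leading coefficient together. Fixing
  \<open>n\<close> means that no powers of \<open>x\<close> have to be aligned.\<close>

lemma ideal_leading_coeffs:
  assumes J: "ideal J R" shows "ideal (leading_coeffs K x J n) (R\<lparr>carrier := K\<rparr>)"
proof -
  interpret J: ideal J R by fact
  interpret K: cring "R\<lparr>carrier := K\<rparr>"
    using subcring_iff subringE(1)[OF K] subcringI'[OF K] by blast
  have inv: "\<ominus>\<^bsub>R\<lparr>carrier := K\<rparr>\<^esub> k = \<ominus> k" if "k \<in> K" for k
    using K.minus_equality[of "\<ominus> k" k] that subringE(5)[OF K that] coeff_carrier[OF that]
    by (simp add: l_neg)
  have smult: "a \<otimes> k \<in> leading_coeffs K x J n" if "k \<in> leading_coeffs K x J n" "a \<in> K" for a k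
  proof -
    from that obtain y where *: "k \<in> K" "y \<in> truncated_span K x n" "y \<oplus> k \<otimes> x [^] n \<in> J"
      unfolding leading_coeffs_def by blast
    note c = truncated_span_carrier[OF *(2)] coeff_carrier[OF *(1)] coeff_carrier[OF that(2)]
      nat_pow_closed[OF x, of n]
    have "a \<otimes> y \<oplus> (a \<otimes> k) \<otimes> x [^] n = a \<otimes> (y \<oplus> k \<otimes> x [^] n)"
      using c by algebra
    then have "a \<otimes> y \<oplus> (a \<otimes> k) \<otimes> x [^] n \<in> J"
      using J.I_l_closed[OF *(3) c(3)] by simp
    then show ?thesis
      unfolding leading_coeffs_def
      using subringE(6)[OF K that(2) *(1)] truncated_span_smult[OF *(2) that(2)] by blast
  qed
  show ?thesis
  proof (rule idealI[OF K.ring_axioms])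
    show "subgroup (leading_coeffs K x J n) (add_monoid (R\<lparr>carrier := K\<rparr>))"
    proof (rule K.add.subgroupI)
      show "leading_coeffs K x J n \<subseteq> carrier (R\<lparr>carrier := K\<rparr>)"
        unfolding leading_coeffs_def by auto
      have "\<zero> \<in> leading_coeffs K x J n"
        unfolding leading_coeffs_def using truncated_span_zero subringE(2)[OF K] x
        by (auto intro!: bexI[of _ \<zero>])
      then show "leading_coeffs K x J n \<noteq> {}" by blast
      fix k assume k: "k \<in> leading_coeffs K x J n"
      then have kK: "k \<in> K" by (simp add: leading_coeffs_def)
      have "\<ominus> \<one> \<otimes> k = \<ominus> k" using l_minus[of \<one> k] coeff_carrier[OF kK] by simp
      then show "\<ominus>\<^bsub>R\<lparr>carrier := K\<rparr>\<^esub> k \<in> leading_coeffs K x J n"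
        using smult[OF k subringE(5)[OF K subringE(3)[OF K]]] inv[OF kK] by simp
      fix l assume l: "l \<in> leading_coeffs K x J n"
      from k obtain y where *: "y \<in> truncated_span K x n" "y \<oplus> k \<otimes> x [^] n \<in> J"
        unfolding leading_coeffs_def by blast
      from l obtain z where **: "l \<in> K" "z \<in> truncated_span K x n" "z \<oplus> l \<otimes> x [^] n \<in> J"
        unfolding leading_coeffs_def by blast
      note c = truncated_span_carrier[OF *(1)] truncated_span_carrier[OF **(2)]
        coeff_carrier[OF kK] coeff_carrier[OF **(1)] nat_pow_closed[OF x, of n]
      have "(y \<oplus> z) \<oplus> (k \<oplus> l) \<otimes> x [^] n = (y \<oplus> k \<otimes> x [^] n) \<oplus> (z \<oplus> l \<otimes> x [^] n)"
        using c by algebra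
      then have "(y \<oplus> z) \<oplus> (k \<oplus> l) \<otimes> x [^] n \<in> J"
        using J.a_closed[OF *(2) **(3)] by simp
      then show "k \<oplus>\<^bsub>R\<lparr>carrier := K\<rparr>\<^esub> l \<in> leading_coeffs K x J n"
        unfolding leading_coeffs_def using subringE(7)[OF K kK **(1)]
          truncated_span_add[OF *(1) **(2)] by auto
    qed
  next
    fix k a assume k: "k \<in> leading_coeffs K x J n" and a: "a \<in> carrier (R\<lparr>carrier := K\<rparr>)"
    have "k \<in> carrier R" "a \<in> carrier R"
      using k a coeff_carrier by (auto simp: leading_coeffs_def)
    then show "a \<otimes>\<^bsub>R\<lparr>carrier := K\<rparr>\<^esub> k \<in> leading_coeffs K x J n"
      and "k \<otimes>\<^bsub>R\<lparr>carrier := K\<rparr>\<^esub> a \<in> leading_coeffs K x J n"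
      using smult[OF k, of a] a by (simp_all add: m_comm)
  qed
qed

lemma leading_coeffs_mono: "J \<subseteq> J' \<Longrightarrow> leading_coeffs K x J n \<subseteq> leading_coeffs K x J' n"
  unfolding leading_coeffs_def by blast

text \<open>Multiplying a representation by \<open>x\<close> raises its formal degree by one, keeps
  the leading coefficient and stays in \<open>J\<close>.\<close>

lemma leading_coeffs_Suc:
  assumes J: "ideal J R" shows "leading_coeffs K x J n \<subseteq> leading_coeffs K x J (Suc n)"
proof
  fix k assume "k \<in> leading_coeffs K x J n"
  then obtain y where *: "k \<in> K" "y \<in> truncated_span K x n" "y \<oplus> k \<otimes> x [^] n \<in> J"
    unfolding leading_coeffs_def by blast
  note c = truncated_span_carrier[OF *(2)] coeff_carrier[OF *(1)] nat_pow_closed[OF x, of n]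
  have "x \<otimes> (y \<oplus> k \<otimes> x [^] n) = (x \<otimes> y) \<oplus> k \<otimes> (x [^] n \<otimes> x)"
    using c x by algebra
  then have "(x \<otimes> y) \<oplus> k \<otimes> x [^] Suc n \<in> J"
    using ideal.I_l_closed[OF J *(3) x] by simp
  then show "k \<in> leading_coeffs K x J (Suc n)"
    unfolding leading_coeffs_def using *(1) truncated_span_shift[OF *(2)] by blast
qed

lemma leading_coeffs_mono_le:
  "ideal J R \<Longrightarrow> m \<le> n \<Longrightarrow> leading_coeffs K x J m \<subseteq> leading_coeffs K x J n"
  by (rule lift_Suc_mono_le[of "leading_coeffs K x J"]) (rule leading_coeffs_Suc)

text \<open>Reduction by leading terms: an element of \<open>U\<close> shares its leading
  coefficient with some element of \<open>J\<close> of the same formal degree. Their difference lies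
  in \<open>U\<close> and has smaller formal degree, so induction puts it in
  \<open>J\<close>.\<close>

lemma leading_coeffs_determine_ideal:
  assumes J: "ideal J R" and U: "ideal U R" and "J \<subseteq> U"
    and L: "\<And>n. leading_coeffs K x U n \<subseteq> leading_coeffs K x J n"
  shows "u \<in> truncated_span K x n \<Longrightarrow> u \<in> U \<Longrightarrow> u \<in> J"
proof (induction n arbitrary: u)
  case 0
  then show ?case
    using additive_subgroup.zero_closed[OF ideal.axioms(1)[OF J]] by simp
next
  case (Suc n)
  interpret J: ideal J R by fact
  interpret U: ideal U R by fact
  from Suc.prems obtain y k where *: "u = y \<oplus> k \<otimes> x [^] n"
      "y \<in> truncated_span K x n" "k \<in> K"
    by auto
  then have "k \<in> leading_coeffs K x J n"
    using L[of n] Suc.prems(2) unfolding leading_coeffs_def by blast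
  then obtain z where z: "z \<in> truncated_span K x n" "z \<oplus> k \<otimes> x [^] n \<in> J"
    unfolding leading_coeffs_def by blast
  note c = truncated_span_carrier[OF *(2)] truncated_span_carrier[OF z(1)]
    coeff_carrier[OF *(3)] nat_pow_closed[OF x, of n]
  \<comment> \<open>Subtracting the element of \<open>J\<close> cancels \<open>k x^n\<close>; only
    the two tails remain.\<close>
  have eq: "y \<oplus> \<ominus> z = u \<oplus> \<ominus> (z \<oplus> k \<otimes> x [^] n)"
    unfolding * using c by algebra
  have "y \<oplus> \<ominus> z \<in> U"
    unfolding eq using Suc.prems(2) z(2) \<open>J \<subseteq> U\<close> by (meson U.a_closed U.a_inv_closed subsetD)
  then have "y \<oplus> \<ominus> z \<in> J"
    using Suc.IH truncated_span_add[OF *(2) truncated_span_a_inv[OF z(1)]] by blast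
  then have "(y \<oplus> \<ominus> z) \<oplus> (z \<oplus> k \<otimes> x [^] n) \<in> J"
    using z(2) by (rule J.a_closed)
  moreover have "(y \<oplus> \<ominus> z) \<oplus> (z \<oplus> k \<otimes> x [^] n) = u"
    unfolding * using c by algebra
  ultimately show ?case by simp
qed

text \<open>The union of all truncations is a subring containing \<open>x\<close> and
  \<open>K\<close>. Closure under products is by induction on the degree bound of the first factor,
  one monomial \<open>k x^n\<close> at a time.\<close>

lemma generate_ring_truncated_span:
  "generate_ring R (insert x K) \<subseteq> (\<Union>n. truncated_span K x n)"
proof -
  let ?V = "\<Union>n. truncated_span K x n"
  have add: "y \<oplus> z \<in> ?V" if "y \<in> ?V" "z \<in> ?V" for y z
  proof -
    from that obtain m n where "y \<in> truncated_span K x m" "z \<in> truncated_span K x n" by blast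
    then have "y \<in> truncated_span K x (max m n)" "z \<in> truncated_span K x (max m n)"
      using truncated_span_mono_le[of m "max m n"] truncated_span_mono_le[of n "max m n"] by auto
    then show ?thesis using truncated_span_add by blast
  qed
  have pow: "x [^] (n::nat) \<otimes> z \<in> ?V" if "z \<in> ?V" for n z
  proof (induction n)
    case 0
    then show ?case using that truncated_span_carrier by auto
  next
    case (Suc n)
    have "z \<in> carrier R" using that truncated_span_carrier by blast
    then have "x [^] Suc n \<otimes> z = x \<otimes> (x [^] n \<otimes> z)"
      using x by (simp add: m_ac)
    moreover obtain m where "x [^] n \<otimes> z \<in> truncated_span K x m" using Suc by blast
    ultimately have "x [^] Suc n \<otimes> z \<in> truncated_span K x (Suc m)"
      using truncated_span_shift by (simp only:)
    then show ?case by blast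
  qed
  have mult: "y \<otimes> z \<in> ?V" if "y \<in> truncated_span K x n" "z \<in> ?V" for y z n
    using that(1)
  proof (induction n arbitrary: y)
    case 0
    have "z \<in> carrier R" using that truncated_span_carrier by blast
    then show ?case using 0 truncated_span_zero by auto
  next
    case (Suc n)
    have z: "z \<in> carrier R" using that truncated_span_carrier by blast
    from Suc.prems obtain y' k where *: "y = y' \<oplus> k \<otimes> x [^] n"
        "y' \<in> truncated_span K x n" "k \<in> K"
      by auto
    note c = truncated_span_carrier[OF *(2)] coeff_carrier[OF *(3)] nat_pow_closed[OF x, of n]
    have "y \<otimes> z = y' \<otimes> z \<oplus> k \<otimes> (x [^] n \<otimes> z)"
      unfolding * using c z by algebra
    moreover have "k \<otimes> (x [^] n \<otimes> z) \<in> ?V"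
      using pow[OF that(2)] truncated_span_smult *(3) by blast
    ultimately show ?case using add Suc.IH[OF *(2)] by simp
  qed
  have Ksub: "k \<in> ?V" if "k \<in> K" for k
  proof -
    have "k = \<zero> \<oplus> k \<otimes> x [^] (0::nat)" using coeff_carrier[OF that] by simp
    then have "k \<in> truncated_span K x (Suc 0)"
      using truncated_span_Suc_I[OF truncated_span_zero that, of 0] by simp
    then show ?thesis by blast
  qed
  show ?thesis
  proof (rule generate_ring_min_subring1)
    show "insert x K \<subseteq> carrier R" using x coeff_carrier by blast
    show "subring ?V R"
    proof (rule subringI)
      show "?V \<subseteq> carrier R" using truncated_span_carrier by blast
      show "\<one> \<in> ?V" using Ksub subringE(3)[OF K] by blast
      show "\<And>h. h \<in> ?V \<Longrightarrow> \<ominus> h \<in> ?V" using truncated_span_a_inv by blast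
      show "\<And>h1 h2. h1 \<in> ?V \<Longrightarrow> h2 \<in> ?V \<Longrightarrow> h1 \<otimes> h2 \<in> ?V" using mult by blast
      show "\<And>h1 h2. h1 \<in> ?V \<Longrightarrow> h2 \<in> ?V \<Longrightarrow> h1 \<oplus> h2 \<in> ?V" using add by blast
    qed
    have "x \<in> ?V"
      using pow[OF Ksub[OF subringE(3)[OF K]], of 1] x by simp
    then show "insert x K \<subseteq> ?V" using Ksub by blast
  qed
qed

text \<open>The noetherian condition is used in the form that a nonempty chain of ideals contains
  its union. For a chain \<open>C\<close> with union \<open>U\<close>, finitely many members of
  \<open>C\<close> already realize the leading coefficients of \<open>U\<close> up to the degree
  where these stabilize. The largest of these members then equals \<open>U\<close>.\<close>

lemma Hilbert_basis:
  assumes K_noeth: "noetherian_ring (R\<lparr>carrier := K\<rparr>)"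
    and gen: "generate_ring R (insert x K) = carrier R"
  shows "noetherian_ring R"
proof (rule trivial_ideal_chain_imp_noetherian)
  fix C assume ne: "C \<noteq> {}" and chain: "subset.chain {I. ideal I R} C"
  interpret KN: noetherian_ring "R\<lparr>carrier := K\<rparr>" by fact
  have C: "ideal J R" if "J \<in> C" for J
    using chain that unfolding pred_on.chain_def by blast
  have lin: "J \<subseteq> J' \<or> J' \<subseteq> J" if "J \<in> C" "J' \<in> C" for J J'
    using chain that unfolding pred_on.chain_def by blast
  define U where "U = \<Union>C"
  have U: "ideal U R"
    using chain_Union_is_ideal[OF chain] ne by (simp add: U_def)
  have chain_K: "\<Union>(range L) \<in> range L"
    if "\<And>n. ideal (L n) (R\<lparr>carrier := K\<rparr>)" "\<And>m n. m \<le> n \<Longrightarrow> L m \<subseteq> L n" for L :: "nat \<Rightarrow> 'a set"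
  proof (rule KN.ideal_chain_is_trivial)
    have "L m \<subseteq> L n \<or> L n \<subseteq> L m" for m n
      using that(2) nat_le_linear[of m n] by blast
    then show "subset.chain {I. ideal I (R\<lparr>carrier := K\<rparr>)} (range L)"
      unfolding pred_on.chain_def using that(1) by blast
  qed simp
  \<comment> \<open>The coefficient ideals of \<open>U\<close> increase with the degree, hence are
    constant from some \<open>N\<close> on.\<close>
  obtain N where N: "(\<Union>n. leading_coeffs K x U n) = leading_coeffs K x U N"
    using chain_K[of "leading_coeffs K x U"] ideal_leading_coeffs[OF U] leading_coeffs_mono_le[OF U]
    by blast
  \<comment> \<open>For a fixed degree the coefficient ideals of the members of \<open>C\<close>
    form a chain in \<open>K\<close>. Its union is the coefficient ideal of \<open>U\<close>, and it
    is attained because \<open>K\<close> is noetherian.\<close>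
  have "\<exists>J\<in>C. leading_coeffs K x U n = leading_coeffs K x J n" for n
  proof -
    have "\<Union>((\<lambda>J. leading_coeffs K x J n) ` C) \<in> (\<lambda>J. leading_coeffs K x J n) ` C"
    proof (rule KN.ideal_chain_is_trivial)
      have "leading_coeffs K x J n \<subseteq> leading_coeffs K x J' n \<or>
          leading_coeffs K x J' n \<subseteq> leading_coeffs K x J n" if "J \<in> C" "J' \<in> C" for J J'
        using lin[OF that] leading_coeffs_mono by metis
      then show "subset.chain {I. ideal I (R\<lparr>carrier := K\<rparr>)} ((\<lambda>J. leading_coeffs K x J n) ` C)"
        unfolding pred_on.chain_def using ideal_leading_coeffs[OF C] by (simp add: image_subset_iff psubset_eq) metis
    qed (use ne in simp)
    moreover have "\<Union>((\<lambda>J. leading_coeffs K x J n) ` C) = leading_coeffs K x U n"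
      unfolding leading_coeffs_def U_def by blast
    ultimately show ?thesis by auto
  qed
  then obtain J where J: "\<And>n. J n \<in> C" "\<And>n. leading_coeffs K x U n = leading_coeffs K x (J n) n"
    by metis
  have "\<exists>M\<in>C. \<forall>n\<le>m. J n \<subseteq> M" for m
  proof (induction m)
    case 0
    then show ?case using J(1) by auto
  next
    case (Suc m)
    then obtain M where "M \<in> C" "\<forall>n\<le>m. J n \<subseteq> M" by blast
    then show ?case
      using lin[OF \<open>M \<in> C\<close> J(1)[of "Suc m"]] J(1)[of "Suc m"] by (metis le_Suc_eq order.trans order_refl)
  qed
  then obtain M where M: "M \<in> C" "\<And>n. n \<le> N \<Longrightarrow> J n \<subseteq> M"
    by metis
  have "leading_coeffs K x U n \<subseteq> leading_coeffs K x M n" for n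
  proof (cases "n \<le> N")
    case True
    then show ?thesis using J(2)[of n] M(2) leading_coeffs_mono by metis
  next
    case False
    \<comment> \<open>Above \<open>N\<close> nothing new appears for \<open>U\<close>, and passing
      from degree \<open>N\<close> to \<open>n\<close> only enlarges the coefficient ideal of
      \<open>M\<close>.\<close>
    have "leading_coeffs K x U n \<subseteq> leading_coeffs K x U N" using N by blast
    also have "\<dots> \<subseteq> leading_coeffs K x M N" using J(2)[of N] M(2)[of N] leading_coeffs_mono by simp
    also have "\<dots> \<subseteq> leading_coeffs K x M n"
      using leading_coeffs_mono_le[OF C[OF M(1)]] False by simp
    finally show ?thesis .
  qed
  then have "u \<in> M" if "u \<in> U" for u
    using leading_coeffs_determine_ideal[OF C[OF M(1)] U, of u] M(1) that
      generate_ring_truncated_span gen ideal.Icarr[OF U] unfolding U_def by blast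
  then have "U = M" using M(1) unfolding U_def by blast
  then show "\<Union>C \<in> C" using M(1) unfolding U_def by simp
qed

end

end

section \<open>Algebras of finite type over a field are noetherian\<close>

text \<open>This lets the basis theorem be applied inside an intermediate ring \<open>B\<close>.
  Both inductions carry membership in \<open>B\<close> along, because additive inverses in the two
  structures are compared only on \<open>B\<close>.\<close>

lemma (in ring) subring_generate_ring_eq:
  assumes "subring B R" "H \<subseteq> B"
  shows "generate_ring (R\<lparr>carrier := B\<rparr>) H = generate_ring R H"
proof -
  interpret B: ring "R\<lparr>carrier := B\<rparr>" using subring_is_ring assms by blast
  have HR: "H \<subseteq> carrier R" using assms subringE(1) by blast
  have inv: "\<ominus>\<^bsub>R\<lparr>carrier := B\<rparr>\<^esub> h = \<ominus> h" if "h \<in> B" for h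
    using B.minus_equality[of "\<ominus> h" h] that subringE(1,5)[OF assms(1)] l_neg by auto
  show ?thesis
  proof (intro equalityI subsetI)
    fix h assume "h \<in> generate_ring (R\<lparr>carrier := B\<rparr>) H"
    then have "h \<in> B \<and> h \<in> generate_ring R H"
    proof (induction rule: generate_ring.induct)
      case one then show ?case using generate_ring.one[of R] subringE(3)[OF assms(1)] by simp
    next
      case (incl h) then show ?case using generate_ring.incl[of h H R] assms(2) by auto
    next
      case (a_inv h) then show ?case
        using inv generate_ring.a_inv[of h R H] subringE(5)[OF assms(1)] by simp
    next
      case (eng_add h1 h2) then show ?case
        using generate_ring.eng_add[of h1 R H h2] subringE(7)[OF assms(1)] by simp
    next
      case (eng_mult h1 h2) then show ?case
        using generate_ring.eng_mult[of h1 R H h2] subringE(6)[OF assms(1)] by simp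
    qed
    then show "h \<in> generate_ring R H" by blast
  next
    fix h assume "h \<in> generate_ring R H"
    then have "h \<in> B \<and> h \<in> generate_ring (R\<lparr>carrier := B\<rparr>) H"
    proof (induction rule: generate_ring.induct)
      case one then show ?case
        using generate_ring.one[of "R\<lparr>carrier := B\<rparr>"] subringE(3)[OF assms(1)] by simp
    next
      case (incl h) then show ?case using generate_ring.incl[of h H "R\<lparr>carrier := B\<rparr>"] assms(2) by auto
    next
      case (a_inv h) then show ?case
        using inv generate_ring.a_inv[of h "R\<lparr>carrier := B\<rparr>" H] subringE(5)[OF assms(1)] by simp
    next
      case (eng_add h1 h2) then show ?case
        using generate_ring.eng_add[of h1 "R\<lparr>carrier := B\<rparr>" H h2] subringE(7)[OF assms(1)] by simp
    next
      case (eng_mult h1 h2) then show ?case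
        using generate_ring.eng_mult[of h1 "R\<lparr>carrier := B\<rparr>" H h2] subringE(6)[OF assms(1)] by simp
    qed
    then show "h \<in> generate_ring (R\<lparr>carrier := B\<rparr>) H" by blast
  qed
qed

lemma (in field) field_is_noetherian: "noetherian_ring R"
proof (rule noetherian_ringI)
  fix I assume "ideal I R"
  then have "I = {\<zero>} \<or> I = carrier R" using all_ideals by auto
  then show "\<exists>A\<subseteq>carrier R. finite A \<and> I = Idl A"
    using genideal_zero genideal_one by (metis empty_subsetI finite.emptyI finite_insert insert_subset one_closed zero_closed)
qed

text \<open>The generators are adjoined one at a time, starting from the field \<open>F\<close>.
  Each step is the basis theorem inside the ring \<open>?B\<close> generated so far, over the
  noetherian subring \<open>?K\<close> without the last generator.\<close>

lemma (in cring) finite_type_over_subfield_imp_noetherian: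
  assumes F: "subfield F R" and ft: "finite_type R F"
  shows "noetherian_ring R"
proof -
  have FR: "F \<subseteq> carrier R" "subring F R"
    using subfieldE(3)[OF F] subfieldE(1)[OF F] subcring.axioms(1) by blast+
  obtain T where T: "finite T" "T \<subseteq> carrier R" "generate_ring R (F \<union> T) = carrier R"
    using ft unfolding finite_type_def by blast
  have "noetherian_ring (R\<lparr>carrier := generate_ring R (F \<union> T)\<rparr>)"
    using T(1,2)
  proof (induction T rule: finite_induct)
    case empty
    have "generate_ring R F = F"
      using generate_ringI[OF FR(1) FR(2)] by blast
    moreover have "field (R\<lparr>carrier := F\<rparr>)"
      using subfield_iff(2)[OF F] .
    ultimately show ?case
      using field.field_is_noetherian by fastforce
  next
    case (insert t T)
    let ?K = "generate_ring R (F \<union> T)" and ?B = "generate_ring R (F \<union> insert t T)"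
    have sub: "F \<union> T \<subseteq> carrier R" "F \<union> insert t T \<subseteq> carrier R"
      using insert.prems FR by auto
    have K: "subring ?K R" and B: "subring ?B R"
      using generate_ring_is_subring sub by blast+
    have KB: "?K \<subseteq> ?B" by (rule mono_generate_ring) (use sub in auto)
    interpret B: cring "R\<lparr>carrier := ?B\<rparr>"
      using subcring_iff subringE(1)[OF B] subcringI'[OF B] by blast
    have tB: "t \<in> ?B" by (rule generate_ring.incl) simp
    have Kc: "?K \<subseteq> carrier R" using subringE(1)[OF K] .
    have tR: "t \<in> carrier R" using insert.prems by simp
    have gen: "generate_ring R (insert t ?K) = ?B"
    proof
      show "generate_ring R (insert t ?K) \<subseteq> ?B"
        by (rule generate_ring_min_subring1[OF _ B]) (use KB tB Kc tR in auto)
      show "?B \<subseteq> generate_ring R (insert t ?K)"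
        by (rule generate_ring_min_subring1[OF sub(2) generate_ring_is_subring])
          (use Kc tR in \<open>auto intro: generate_ring.incl\<close>)
    qed
    have KsB: "subring ?K (R\<lparr>carrier := ?B\<rparr>)"
      by (rule B.ring_incl_imp_subring) (use KB subring_is_ring[OF K] in auto)
    show ?case
    proof (rule B.Hilbert_basis[OF KsB])
      show "t \<in> carrier (R\<lparr>carrier := ?B\<rparr>)" using tB by simp
      show "noetherian_ring (R\<lparr>carrier := ?B, carrier := ?K\<rparr>)"
        using insert.IH insert.prems by simp
      show "generate_ring (R\<lparr>carrier := ?B\<rparr>) (insert t ?K) = carrier (R\<lparr>carrier := ?B\<rparr>)"
        using gen subring_generate_ring_eq[OF B, of "insert t ?K"] KB tB by simp
    qed
  qed
  then show ?thesis using T(3) by simp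
qed


section \<open>Primes and maximal ideals in noetherian rings\<close>

text \<open>A nonempty chain of ideals contains its union, so Zorn's lemma applies to every nonempty
  family of ideals. The empty chain is bounded by any member of the family.\<close>

lemma (in noetherian_ring) exists_maximal_ideal_in:
  assumes "\<S> \<subseteq> {I. ideal I R}" and "\<S> \<noteq> {}"
  shows "\<exists>M\<in>\<S>. \<forall>I\<in>\<S>. M \<subseteq> I \<longrightarrow> I = M"
proof (rule subset_Zorn)
  fix C assume C: "subset.chain \<S> C"
  show "\<exists>U\<in>\<S>. \<forall>I\<in>C. I \<subseteq> U"
  proof (cases "C = {}")
    case True
    then show ?thesis using assms(2) by blast
  next
    case False
    have "subset.chain {I. ideal I R} C"
      using C assms(1) unfolding pred_on.chain_def by blast
    then have UC: "\<Union>C \<in> C" by (rule ideal_chain_is_trivial[OF False])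
    have "\<Union>C \<in> \<S>" using C UC unfolding pred_on.chain_def by (elim conjE) (erule (1) subsetD)
    then show ?thesis by (meson Union_upper)
  qed
qed

text \<open>This is the colon ideal \<open>J : b\<close>. It serves to enlarge an ideal in a
  maximality argument, and to pass from generators to the ideal they generate.\<close>

lemma (in cring) ideal_colon:
  assumes J: "ideal J R" and b: "b \<in> carrier R"
  shows "ideal {x \<in> carrier R. b \<otimes> x \<in> J} R"
proof -
  interpret J: ideal J R by fact
  show ?thesis
  proof (rule idealI[OF ring_axioms])
    show "subgroup {x \<in> carrier R. b \<otimes> x \<in> J} (add_monoid R)"
    proof (rule add.subgroupI)
      show "{x \<in> carrier R. b \<otimes> x \<in> J} \<noteq> {}"
        using b by (auto intro!: exI[of _ \<zero>])
    qed (use b in \<open>auto simp: r_minus r_distr\<close>)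
  next
    fix a x assume a: "a \<in> {x \<in> carrier R. b \<otimes> x \<in> J}" and x: "x \<in> carrier R"
    have "b \<otimes> (x \<otimes> a) = x \<otimes> (b \<otimes> a)" using a x b by (simp add: m_ac)
    then show "x \<otimes> a \<in> {x \<in> carrier R. b \<otimes> x \<in> J}" using a x J.I_l_closed by simp
    then show "a \<otimes> x \<in> {x \<in> carrier R. b \<otimes> x \<in> J}" using a x by (simp add: m_comm)
  qed
qed

text \<open>An ideal that is maximal among those containing \<open>J\<close> and missing the
  multiplicative set \<open>M\<close> is prime.\<close>

lemma (in cring) exists_prime_avoiding:
  assumes "noetherian_ring R" and J: "ideal J R" and "\<one> \<in> M" and MR: "M \<subseteq> carrier R"
    and mult: "\<And>a b. a \<in> M \<Longrightarrow> b \<in> M \<Longrightarrow> a \<otimes> b \<in> M" and disj: "J \<inter> M = {}"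
  shows "\<exists>P. primeideal P R \<and> J \<subseteq> P \<and> P \<inter> M = {}"
proof -
  interpret noetherian_ring R by fact
  let ?\<S> = "{I. ideal I R \<and> J \<subseteq> I \<and> I \<inter> M = {}}"
  have "J \<in> ?\<S>" using J disj by simp
  then have "?\<S> \<subseteq> {I. ideal I R}" "?\<S> \<noteq> {}" by (simp_all only: Collect_mono_iff) auto
  from exists_maximal_ideal_in[OF this]
  obtain P where "P \<in> ?\<S>" and P_max: "\<forall>I\<in>?\<S>. P \<subseteq> I \<longrightarrow> I = P"
      by (elim bexE)
  then have P: "ideal P R" "J \<subseteq> P" "P \<inter> M = {}" by simp_all
  have max: "I \<inter> M \<noteq> {}" if "ideal I R" "P \<subset> I" for I
    using P_max[rule_format, of I] that P(2) by auto
  interpret P: ideal P R by fact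
  have meets: "\<exists>m\<in>M. b \<otimes> m \<in> P" if "b \<in> carrier R" "a \<in> carrier R" "a \<notin> P" "b \<otimes> a \<in> P" for a b
  proof -
    \<comment> \<open>The colon ideal \<open>P : b\<close> contains \<open>a\<close> in addition to
      \<open>P\<close>, so by maximality it meets \<open>M\<close>.\<close>
    have "P \<subset> {x \<in> carrier R. b \<otimes> x \<in> P}"
      using that P.I_l_closed P.Icarr by blast
    then show ?thesis using max[OF ideal_colon[OF P(1) that(1)]] by blast
  qed
  have "primeideal P R"
  proof (rule primeidealI[OF P(1) cring_axioms])
    show "carrier R \<noteq> P" using P(3) \<open>\<one> \<in> M\<close> by blast
    fix a b assume ab: "a \<in> carrier R" "b \<in> carrier R" "a \<otimes> b \<in> P"
    show "a \<in> P \<or> b \<in> P"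
    proof (rule ccontr)
      assume "\<not> (a \<in> P \<or> b \<in> P)"
      \<comment> \<open>The factors are exchanged one after the other for elements of
        \<open>M\<close>: first \<open>b\<close> for \<open>m\<close>, then \<open>a\<close> for
        \<open>n\<close>. The product \<open>m n\<close> then lies in both \<open>M\<close> and
        \<open>P\<close>.\<close>
      then obtain m where m: "m \<in> M" "a \<otimes> m \<in> P" using meets ab by blast
      then have "m \<otimes> a \<in> P" using ab MR by (metis m_comm subsetD)
      then obtain n where "n \<in> M" "m \<otimes> n \<in> P"
        using meets[of m a] m ab MR \<open>\<not> (a \<in> P \<or> b \<in> P)\<close> by blast
      then show False using mult[OF m(1)] P(3) by blast
    qed
  qed
  then show ?thesis using P by blast
qed

text \<open>The elements that some member of \<open>S\<close> multiplies into \<open>J\<close> form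
  an ideal \<open>T\<close>, the preimage of the \<open>S\<close>-torsion of \<open>R/J\<close>. It
  is finitely generated, and a product of denominators for the generators serves all of
  \<open>T\<close>.\<close>

lemma (in cring) exists_uniform_denominator:
  assumes "noetherian_ring R" and J: "ideal J R" and S: "submonoid S R"
  shows "\<exists>d\<in>S. \<forall>e\<in>S. \<forall>x\<in>carrier R. e \<otimes> x \<in> J \<longrightarrow> d \<otimes> x \<in> J"
proof -
  interpret noetherian_ring R by fact
  interpret S: submonoid S R by fact
  interpret J: ideal J R by fact
  have SR: "s \<in> carrier R" if "s \<in> S" for s using S.subset that by blast
  define T where "T = {x \<in> carrier R. \<exists>d\<in>S. d \<otimes> x \<in> J}"
  have "ideal T R"
  proof (rule idealI[OF ring_axioms])
    show "subgroup T (add_monoid R)"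
    proof (rule add.subgroupI)
      show "T \<subseteq> carrier R" unfolding T_def by blast
      have "\<zero> \<in> T" unfolding T_def by (intro CollectI conjI bexI[OF _ S.one_closed]) simp_all
      then show "T \<noteq> {}" by blast
      show "\<ominus> x \<in> T" if "x \<in> T" for x
        using that unfolding T_def by (auto simp: r_minus SR)
      show "x \<oplus> y \<in> T" if xy: "x \<in> T" "y \<in> T" for x y
      proof -
        obtain d e where *: "d \<in> S" "e \<in> S" "d \<otimes> x \<in> J" "e \<otimes> y \<in> J" "x \<in> carrier R" "y \<in> carrier R"
          using xy unfolding T_def by blast
        have "(d \<otimes> e) \<otimes> (x \<oplus> y) = e \<otimes> (d \<otimes> x) \<oplus> d \<otimes> (e \<otimes> y)"
          using * SR[OF *(1)] SR[OF *(2)] by algebra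
        then have "(d \<otimes> e) \<otimes> (x \<oplus> y) \<in> J"
          using * SR J.I_l_closed by simp
        then show ?thesis unfolding T_def using * by blast
      qed
    qed
  next
    fix a x assume a: "a \<in> T" and x: "x \<in> carrier R"
    then obtain d where *: "d \<in> S" "d \<otimes> a \<in> J" "a \<in> carrier R" unfolding T_def by blast
    have "d \<otimes> (x \<otimes> a) = x \<otimes> (d \<otimes> a)" using * SR x by (simp add: m_ac)
    then have "d \<otimes> (x \<otimes> a) \<in> J" using * x J.I_l_closed by simp
    then show "x \<otimes> a \<in> T" unfolding T_def using * x by auto
    then show "a \<otimes> x \<in> T" using * x by (simp add: m_comm)
  qed
  then obtain G where G: "G \<subseteq> carrier R" "finite G" "T = Idl G"
    using finetely_gen by blast
  have "G \<subseteq> T" using genideal_self[OF G(1)] G(3) by blast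
  with G(2) have "\<exists>d\<in>S. \<forall>x\<in>G. d \<otimes> x \<in> J"
  proof (induction G rule: finite_induct)
    case empty
    then show ?case using S.one_closed by blast
  next
    case (insert g G)
    then obtain d e where *: "d \<in> S" "\<forall>x\<in>G. d \<otimes> x \<in> J" "e \<in> S" "e \<otimes> g \<in> J"
      unfolding T_def by blast
    have gc: "g \<in> carrier R" "G \<subseteq> carrier R" using insert.prems unfolding T_def by blast+
    have "(d \<otimes> e) \<otimes> x \<in> J" if x: "x \<in> insert g G" for x
    proof (cases "x = g")
      case True
      then show ?thesis using * gc SR J.I_l_closed m_assoc by metis
    next
      case False
      then have "x \<in> carrier R" "d \<otimes> x \<in> J" using x gc * by auto
      moreover have "(d \<otimes> e) \<otimes> x = e \<otimes> (d \<otimes> x)"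
        using SR[OF *(1)] SR[OF *(3)] \<open>x \<in> carrier R\<close> by algebra
      ultimately show ?thesis using J.I_l_closed SR[OF *(3)] by simp
    qed
    then show ?case using * by blast
  qed
  then obtain d where d: "d \<in> S" "\<forall>x\<in>G. d \<otimes> x \<in> J" by blast
  \<comment> \<open>The colon ideal \<open>J : d\<close> contains the generators of
    \<open>T\<close>, hence \<open>T\<close>.\<close>
  have "T \<subseteq> {x \<in> carrier R. d \<otimes> x \<in> J}"
    unfolding G(3) by (rule genideal_minimal[OF ideal_colon[OF J SR[OF d(1)]]]) (use d G in auto)
  then show ?thesis using d unfolding T_def by blast
qed

text \<open>Lying inside \<open>Q\<close> and missing \<open>c\<close> are combined into avoidance
  of a single multiplicative set. That this set misses \<open>J\<close> is exactly what the
  nonzerodivisor property modulo \<open>J\<close> gives.\<close>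

lemma (in cring) exists_prime_avoiding_nonzerodivisor:
  assumes noeth: "noetherian_ring R" and c: "c \<in> carrier R" and Q: "primeideal Q R"
    and J: "ideal J R" and "J \<subseteq> Q"
    and nzd: "\<And>x. x \<in> carrier R \<Longrightarrow> c \<otimes> x \<in> J \<Longrightarrow> x \<in> J"
  shows "\<exists>P. primeideal P R \<and> J \<subseteq> P \<and> P \<subseteq> Q \<and> c \<notin> P"
proof -
  interpret Q: primeideal Q R by fact
  \<comment> \<open>The exponent 0 yields all elements outside \<open>Q\<close>, and
    \<open>u = 1\<close> with exponent 1 yields \<open>c\<close>.\<close>
  define M where "M = {u \<otimes> c [^] k | u k. u \<in> carrier R - Q \<and> k \<in> (UNIV :: nat set)}"
  have MI: "u \<otimes> c [^] k \<in> M" if "u \<in> carrier R - Q" for u and k :: nat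
    unfolding M_def using that by blast
  have one: "\<one> \<in> carrier R - Q" using Q.I_notcarr Q.one_imp_carrier by blast
  have "\<exists>P. primeideal P R \<and> J \<subseteq> P \<and> P \<inter> M = {}"
  proof (rule exists_prime_avoiding[OF noeth J])
    show "\<one> \<in> M" using MI[OF one, of 0] by simp
    show "M \<subseteq> carrier R" unfolding M_def using c by auto
    show "a \<otimes> b \<in> M" if ab: "a \<in> M" "b \<in> M" for a b
    proof -
      obtain u k v l where *: "a = u \<otimes> c [^] (k::nat)" "b = v \<otimes> c [^] (l::nat)"
          "u \<in> carrier R - Q" "v \<in> carrier R - Q"
        using ab unfolding M_def by blast
      have "u \<otimes> v \<in> carrier R - Q" using * Q.I_prime by blast
      moreover have "a \<otimes> b = (u \<otimes> v) \<otimes> c [^] (k + l)"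
        using * c by (simp add: nat_pow_mult[symmetric] m_ac)
      ultimately show ?thesis using MI by simp
    qed
    \<comment> \<open>Powers of \<open>c\<close> are cancelled modulo \<open>J\<close> one factor at
      a time; what remains is \<open>u\<close>, which would lie in \<open>J\<close> and so in
      \<open>Q\<close>.\<close>
    have "u \<in> J" if "u \<in> carrier R" "u \<otimes> c [^] k \<in> J" for u and k :: nat
      using that(2)
    proof (induction k)
      case 0
      then show ?case using that(1) by simp
    next
      case (Suc k)
      have "c \<otimes> (u \<otimes> c [^] k) \<in> J" using Suc.prems that(1) c by (simp add: m_ac)
      then show ?case using Suc.IH nzd[of "u \<otimes> c [^] k"] that(1) c by simp
    qed
    then show "J \<inter> M = {}" unfolding M_def using \<open>J \<subseteq> Q\<close> by blast
  qed
  then obtain P where P: "primeideal P R" "J \<subseteq> P" "P \<inter> M = {}" by blast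
  have "c \<notin> P" using MI[OF one, of 1] c P(3) by auto
  moreover have "P \<subseteq> Q"
  proof
    fix u assume u: "u \<in> P"
    then have "u \<in> carrier R" using ideal.Icarr[OF primeideal.axioms(1)[OF P(1)]] by blast
    then show "u \<in> Q" using MI[of u 0] u P(3) by auto
  qed
  ultimately show ?thesis using P by blast
qed

section \<open>One-dimensional noetherian domains\<close>

text \<open>Otherwise the zero ideal, \<open>P\<close> and \<open>Q\<close> form a strict chain; it
  has length 2, since lengths count inclusions.\<close>

lemma (in domain) nonzero_prime_maximal_if_krull_dim_1:
  assumes dim: "krull_dim R = 1" and P: "primeideal P R" "P \<noteq> {\<zero>}"
    and Q: "primeideal Q R" "P \<subseteq> Q"
  shows "P = Q"
proof (rule ccontr)
  assume "P \<noteq> Q"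
  define C where "C = (\<lambda>i::nat. if i = 0 then {\<zero>} else if i = 1 then P else Q)"
  have "\<zero> \<in> P"
    using P(1) by (simp add: additive_subgroup.zero_closed ideal.axioms(1) primeideal.axioms(1))
  then have "\<forall>i<2. C i \<subset> C (Suc i)"
    using P Q \<open>P \<noteq> Q\<close> by (auto simp: C_def less_2_cases_iff)
  moreover have "\<forall>i\<le>2. primeideal (C i) R"
    using P Q zeroprimeideal by (simp add: C_def)
  ultimately have "enat 2 \<le> krull_dim R"
    unfolding krull_dim_def by (intro SUP_upper) blast
  then show False unfolding dim by (simp add: one_enat_def)
qed

text \<open>Positive dimension supplies a strict inclusion of primes \<open>P 0\<close> and
  \<open>P 1\<close>. A zero maximal ideal would be strictly below the proper ideal
  \<open>P 1\<close>. In particular the ring is not a field.\<close>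

lemma (in domain) maximal_ideal_nonzero_if_krull_dim_1:
  assumes dim: "krull_dim R = 1" and M: "maximalideal M R"
  shows "M \<noteq> {\<zero>}"
proof
  assume M0: "M = {\<zero>}"
  have "\<not> krull_dim R \<le> enat 0" unfolding dim by (simp add: one_enat_def)
  then obtain n P where nP: "\<not> enat n \<le> enat 0"
      and prime: "\<And>i. i \<le> n \<Longrightarrow> primeideal (P i) R" and chain: "\<And>i. i < n \<Longrightarrow> P i \<subset> P (Suc i)"
    unfolding krull_dim_def SUP_le_iff by blast
  have n: "0 < n" using nP by simp
  have P: "primeideal (P 1) R" "P 0 \<subset> P 1"
    using prime[of 1] chain[of 0] n by auto
  have "\<zero> \<in> P 0"
    using prime[of 0] by (simp add: additive_subgroup.zero_closed ideal.axioms(1) primeideal.axioms(1))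
  then have "M \<subseteq> P 0" unfolding M0 by blast
  then have "M \<subset> P 1" using P(2) by (rule subset_psubset_trans)
  moreover have "P 1 \<noteq> carrier R" using P(1) primeideal.I_notcarr by blast
  moreover have "P 1 \<subseteq> carrier R"
    using ideal.Icarr[OF primeideal.axioms(1)[OF P(1)]] by blast
  ultimately show False
    using maximalideal.I_maximal[OF M primeideal.axioms(1)[OF P(1)]] by blast
qed

text \<open>Noetherian induction: let \<open>M\<close> be maximal among the nonzero ideals contained
  in infinitely many maximal ideals. It is neither the whole ring nor prime, so \<open>a b\<close>
  lies in \<open>M\<close> for some \<open>a\<close>, \<open>b\<close> outside \<open>M\<close>.
  Every maximal ideal over \<open>M\<close> contains \<open>M + (a)\<close> or
  \<open>M + (b)\<close>, and each of these has only finitely many above it.\<close>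

lemma (in domain) finite_maximal_ideals_containing:
  assumes noeth: "noetherian_ring R" and dim: "krull_dim R = 1" and g: "g \<in> carrier R" "g \<noteq> \<zero>"
  shows "finite {\<mm>. maximalideal \<mm> R \<and> g \<in> \<mm>}"
proof -
  interpret noetherian_ring R by fact
  let ?V = "\<lambda>J. {\<mm>. maximalideal \<mm> R \<and> J \<subseteq> \<mm>}"
  have fin: "finite (?V J)" if J: "ideal J R" "J \<noteq> {\<zero>}" for J
  proof (rule ccontr)
    assume "infinite (?V J)"
    let ?\<S> = "{J. ideal J R \<and> J \<noteq> {\<zero>} \<and> infinite (?V J)}"
    have "J \<in> ?\<S>" using J \<open>infinite (?V J)\<close> by simp
    then have "?\<S> \<subseteq> {I. ideal I R}" "?\<S> \<noteq> {}" by (simp_all only: Collect_mono_iff) auto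
    from exists_maximal_ideal_in[OF this]
    obtain M where "M \<in> ?\<S>" and M_max: "\<forall>I\<in>?\<S>. M \<subseteq> I \<longrightarrow> I = M"
      by (elim bexE)
    then have M: "ideal M R" "M \<noteq> {\<zero>}" "infinite (?V M)" by simp_all
    have max: "finite (?V I)" if "ideal I R" "M \<subset> I" "I \<noteq> {\<zero>}" for I
      using M_max[rule_format, of I] that by auto
    interpret M: ideal M R by fact
    have z: "\<zero> \<in> M" by simp
    have "M \<noteq> carrier R"
    proof
      assume "M = carrier R"
      then have "\<not> M \<subseteq> \<mm>" if "maximalideal \<mm> R" for \<mm>
        using maximalideal.I_notcarr[OF that] ideal.Icarr[OF maximalideal.axioms(1)[OF that]] by blast
      then have "?V M = {}" by blast
      then show False using M(3) by (metis finite.emptyI)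
    qed
    have "\<not> primeideal M R"
    proof
      assume "primeideal M R"
      \<comment> \<open>In dimension one a nonzero prime has no maximal ideal above it other than
        itself.\<close>
      then have "?V M \<subseteq> {M}"
        using nonzero_prime_maximal_if_krull_dim_1[OF dim _ M(2)] maximalideal_prime by blast
      then show False using M(3) finite_subset by blast
    qed
    then obtain a b where ab: "a \<in> carrier R" "b \<in> carrier R" "a \<otimes> b \<in> M" "a \<notin> M" "b \<notin> M"
      using primeidealI[OF M(1) cring_axioms] \<open>M \<noteq> carrier R\<close> by blast
    have fin': "finite (?V (Idl (insert x M)))" if x: "x \<in> carrier R" "x \<notin> M" for x
    proof (rule max)
      have sub: "insert x M \<subseteq> carrier R" using x M.Icarr by blast
      show "ideal (Idl (insert x M)) R" using genideal_ideal[OF sub] .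
      show "M \<subset> Idl (insert x M)" using genideal_self[OF sub] x by blast
      then show "Idl (insert x M) \<noteq> {\<zero>}"
        using z by (metis insert_absorb insert_iff psubset_eq singletonD subsetI subset_antisym subset_singletonD empty_iff)
    qed
    have "?V M \<subseteq> ?V (Idl (insert a M)) \<union> ?V (Idl (insert b M))"
    proof
      fix \<mm> assume \<mm>: "\<mm> \<in> ?V M"
      then have "primeideal \<mm> R" using maximalideal_prime by blast
      then have "a \<in> \<mm> \<or> b \<in> \<mm>"
        using primeideal.I_prime[of \<mm> R a b] ab(1-3) \<mm> by (simp add: subset_iff)
      then have "insert a M \<subseteq> \<mm> \<or> insert b M \<subseteq> \<mm>" using \<mm> by auto
      then have "Idl (insert a M) \<subseteq> \<mm> \<or> Idl (insert b M) \<subseteq> \<mm>"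
        using genideal_minimal[OF maximalideal.axioms(1), of \<mm>] \<mm> by blast
      then show "\<mm> \<in> ?V (Idl (insert a M)) \<union> ?V (Idl (insert b M))"
        using \<mm> by simp
    qed
    moreover have "finite (?V (Idl (insert a M)) \<union> ?V (Idl (insert b M)))"
      using fin'[OF ab(1,4)] fin'[OF ab(2,5)] by (rule finite_UnI)
    ultimately have "finite (?V M)" by (rule finite_subset)
    with M(3) show False by (rule notE)
  qed
  have "finite (?V (PIdl g))"
    using cgenideal_self[OF g(1)] g(2) by (intro fin[OF cgenideal_ideal[OF g(1)]]) auto
  moreover have "{\<mm>. maximalideal \<mm> R \<and> g \<in> \<mm>} \<subseteq> ?V (PIdl g)"
    using cgenideal_minimal[OF maximalideal.axioms(1)] by auto
  ultimately show ?thesis by (rule rev_finite_subset)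
qed


section \<open>Tensor products and fibers\<close>

lemma zero_FactRing: "\<zero>\<^bsub>R Quot I\<^esub> = I"
  by (simp add: FactRing_def)

lemma free_pair_ring_simps:
  "carrier (free_pair_ring R T) = {x. Poly_Mapping.keys x \<subseteq> carrier R \<times> carrier T}"
  "\<zero>\<^bsub>free_pair_ring R T\<^esub> = 0" "\<one>\<^bsub>free_pair_ring R T\<^esub> = frag_of (\<one>\<^bsub>R\<^esub>, \<one>\<^bsub>T\<^esub>)"
  "x \<oplus>\<^bsub>free_pair_ring R T\<^esub> y = x + y"
  by (simp_all add: free_pair_ring_def)

lemma frag_extend_fun_diff:
  "frag_extend (\<lambda>a. f a - g a) x = frag_extend f x - frag_extend g x"
  by (rule frag_induction[of x UNIV]) (auto simp: frag_extend_diff)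

lemma free_pair_ring_mult_frag_of:
  "frag_of (r, t) \<otimes>\<^bsub>free_pair_ring R T\<^esub> frag_of (r', t') = frag_of (r \<otimes>\<^bsub>R\<^esub> r', t \<otimes>\<^bsub>T\<^esub> t')"
  by (simp add: free_pair_ring_def)

lemma free_pair_ring_mult_zero:
  "0 \<otimes>\<^bsub>free_pair_ring R T\<^esub> x = 0" "x \<otimes>\<^bsub>free_pair_ring R T\<^esub> 0 = 0"
  by (simp_all add: free_pair_ring_def frag_extend_def split_def)

text \<open>\<open>frag_induction\<close> builds elements from zero, generators and differences.
  Bilinearity in this form therefore reduces identities for the product to generators.\<close>

lemma free_pair_ring_mult_diff:
  "(x - y) \<otimes>\<^bsub>free_pair_ring R T\<^esub> z = x \<otimes>\<^bsub>free_pair_ring R T\<^esub> z - y \<otimes>\<^bsub>free_pair_ring R T\<^esub> z"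
  "z \<otimes>\<^bsub>free_pair_ring R T\<^esub> (x - y) = z \<otimes>\<^bsub>free_pair_ring R T\<^esub> x - z \<otimes>\<^bsub>free_pair_ring R T\<^esub> y"
  by (simp_all add: free_pair_ring_def frag_extend_diff split_def frag_extend_fun_diff)

lemma free_pair_ring_mult_add_left:
  "(x + y) \<otimes>\<^bsub>free_pair_ring R T\<^esub> z = x \<otimes>\<^bsub>free_pair_ring R T\<^esub> z + y \<otimes>\<^bsub>free_pair_ring R T\<^esub> z"
  by (simp add: free_pair_ring_def frag_extend_add)

lemma free_pair_ring_mult_closed:
  assumes "monoid R" "monoid T"
    and "x \<in> carrier (free_pair_ring R T)" "y \<in> carrier (free_pair_ring R T)"
  shows "x \<otimes>\<^bsub>free_pair_ring R T\<^esub> y \<in> carrier (free_pair_ring R T)"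
proof -
  have diff: "a - b \<in> carrier (free_pair_ring R T)"
    if "a \<in> carrier (free_pair_ring R T)" "b \<in> carrier (free_pair_ring R T)" for a b
    using that keys_diff[of a b] by (auto simp: free_pair_ring_simps)
  have "Poly_Mapping.keys x \<subseteq> carrier R \<times> carrier T"
    and y: "Poly_Mapping.keys y \<subseteq> carrier R \<times> carrier T"
    using assms(3,4) by (simp_all add: free_pair_ring_simps)
  then show ?thesis
  proof (induction x rule: frag_induction)
    case (one a)
    from y show ?case
    proof (induction y rule: frag_induction)
      case (one b)
      then show ?case
        using \<open>a \<in> _\<close> monoid.m_closed[OF assms(1)] monoid.m_closed[OF assms(2)]
        by (cases a, cases b) (auto simp: free_pair_ring_mult_frag_of free_pair_ring_simps)
    qed (simp_all add: free_pair_ring_mult_zero free_pair_ring_mult_diff diff, simp add: free_pair_ring_simps)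
  qed (simp_all add: free_pair_ring_mult_zero free_pair_ring_mult_diff diff, simp add: free_pair_ring_simps)
qed

text \<open>By bilinearity, commutativity, associativity and the unit law need checking only on
  generators, where they hold componentwise.\<close>

lemma cring_free_pair_ring:
  assumes "cring R" "cring T" shows "cring (free_pair_ring R T)"
proof -
  interpret R: cring R by fact
  interpret T: cring T by fact
  let ?P = "free_pair_ring R T" and ?S = "carrier R \<times> carrier T"
  have comm: "x \<otimes>\<^bsub>?P\<^esub> y = y \<otimes>\<^bsub>?P\<^esub> x"
    if x: "Poly_Mapping.keys x \<subseteq> ?S" and y: "Poly_Mapping.keys y \<subseteq> ?S" for x y
    using x
  proof (induction x rule: frag_induction)
    case (one a)
    from y show ?case
    proof (induction y rule: frag_induction)
      case (one b)
      then show ?case using \<open>a \<in> _\<close>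
        by (cases a, cases b) (simp add: free_pair_ring_mult_frag_of R.m_comm T.m_comm)
    qed (simp_all add: free_pair_ring_mult_zero free_pair_ring_mult_diff)
  qed (simp_all add: free_pair_ring_mult_zero free_pair_ring_mult_diff)
  have assoc: "(x \<otimes>\<^bsub>?P\<^esub> y) \<otimes>\<^bsub>?P\<^esub> z = x \<otimes>\<^bsub>?P\<^esub> (y \<otimes>\<^bsub>?P\<^esub> z)"
    if x: "Poly_Mapping.keys x \<subseteq> ?S" and y: "Poly_Mapping.keys y \<subseteq> ?S"
      and z: "Poly_Mapping.keys z \<subseteq> ?S" for x y z
    using x
  proof (induction x rule: frag_induction)
    case (one a)
    from y show ?case
    proof (induction y rule: frag_induction)
      case (one b)
      from z show ?case
      proof (induction z rule: frag_induction)
        case (one c)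
        then show ?case using \<open>a \<in> _\<close> \<open>b \<in> _\<close>
          by (cases a, cases b, cases c)
            (simp add: free_pair_ring_mult_frag_of R.m_assoc T.m_assoc)
      qed (simp_all add: free_pair_ring_mult_zero free_pair_ring_mult_diff)
    qed (simp_all add: free_pair_ring_mult_zero free_pair_ring_mult_diff)
  qed (simp_all add: free_pair_ring_mult_zero free_pair_ring_mult_diff)
  have one: "\<one>\<^bsub>?P\<^esub> \<otimes>\<^bsub>?P\<^esub> x = x" if x: "Poly_Mapping.keys x \<subseteq> ?S" for x
    using x
    by (induction x rule: frag_induction)
      (auto simp: free_pair_ring_simps free_pair_ring_mult_zero free_pair_ring_mult_diff
        free_pair_ring_mult_frag_of)
  show ?thesis
  proof (rule cringI)
    show "abelian_group ?P"
    proof (rule abelian_groupI)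
      fix x assume "x \<in> carrier ?P"
      then show "\<exists>y\<in>carrier ?P. y \<oplus>\<^bsub>?P\<^esub> x = \<zero>\<^bsub>?P\<^esub>"
        by (intro bexI[of _ "- x"]) (simp_all add: free_pair_ring_simps)
    next
      fix x y assume "x \<in> carrier ?P" "y \<in> carrier ?P"
      then show "x \<oplus>\<^bsub>?P\<^esub> y \<in> carrier ?P"
        using Poly_Mapping.keys_add[of x y] by (auto simp: free_pair_ring_simps)
    qed (simp_all add: free_pair_ring_simps)
    show "comm_monoid ?P"
    proof (rule comm_monoidI)
      show "\<And>x y. x \<in> carrier ?P \<Longrightarrow> y \<in> carrier ?P \<Longrightarrow> x \<otimes>\<^bsub>?P\<^esub> y \<in> carrier ?P"
        using free_pair_ring_mult_closed R.monoid_axioms T.monoid_axioms by metis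
      show "\<one>\<^bsub>?P\<^esub> \<in> carrier ?P" by (simp add: free_pair_ring_simps)
    qed (use comm assoc one in \<open>simp_all add: free_pair_ring_simps\<close>)
    show "\<And>x y z. (x \<oplus>\<^bsub>?P\<^esub> y) \<otimes>\<^bsub>?P\<^esub> z = x \<otimes>\<^bsub>?P\<^esub> z \<oplus>\<^bsub>?P\<^esub> y \<otimes>\<^bsub>?P\<^esub> z"
      by (simp add: free_pair_ring_simps free_pair_ring_mult_add_left)
  qed
qed

text \<open>The tensor relations are written with the subtraction of \<open>Poly_Mapping\<close>,
  whereas ideals and cosets speak of the subtraction of the ring.\<close>

lemma free_pair_ring_minus:
  assumes "cring R" "cring T"
    and x: "x \<in> carrier (free_pair_ring R T)" and y: "y \<in> carrier (free_pair_ring R T)"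
  shows "x \<ominus>\<^bsub>free_pair_ring R T\<^esub> y = x - y"
proof -
  interpret P: cring "free_pair_ring R T" using cring_free_pair_ring assms(1,2) .
  have "\<ominus>\<^bsub>free_pair_ring R T\<^esub> y = - y"
    by (rule P.minus_equality) (use y in \<open>simp_all add: free_pair_ring_simps\<close>)
  then show ?thesis by (simp add: a_minus_def free_pair_ring_simps)
qed

lemma tensor_relations_carrier:
  assumes "cring R" "cring T" and \<alpha>: "\<And>k. k \<in> carrier K \<Longrightarrow> \<alpha> k \<in> carrier R"
    and \<beta>: "\<And>k. k \<in> carrier K \<Longrightarrow> \<beta> k \<in> carrier T"
  shows "tensor_relations K R \<alpha> T \<beta> \<subseteq> carrier (free_pair_ring R T)"
proof -
  interpret R: cring R by fact
  interpret T: cring T by fact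
  interpret P: cring "free_pair_ring R T" using cring_free_pair_ring assms(1,2) .
  have diff: "x - y \<in> carrier (free_pair_ring R T)"
    if "x \<in> carrier (free_pair_ring R T)" "y \<in> carrier (free_pair_ring R T)" for x y
    using P.minus_closed[OF that] free_pair_ring_minus[OF assms(1,2) that] by simp
  have of: "frag_of (r, t) \<in> carrier (free_pair_ring R T)" if "r \<in> carrier R" "t \<in> carrier T" for r t
    using that by (simp add: free_pair_ring_simps)
  show ?thesis
    unfolding tensor_relations_def by (auto intro!: diff of \<alpha> \<beta>)
qed

section \<open>Homomorphisms out of the pair ring and the tensor product\<close>

lemmas free_Abelian_group_diff_induct =
  free_Abelian_group_induct[consumes 1, case_names zero diff frag_of]

text \<open>The additive map exists by the universal property of the free abelian group. Its
  multiplicativity follows by induction on each argument in turn, since both sides are biadditive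
  and agree on generators.\<close>

lemma (in cring) free_pair_ring_universal:
  assumes "cring S" "cring T" and u: "u \<in> ring_hom S R" and v: "v \<in> ring_hom T R"
  obtains h where "h \<in> ring_hom (free_pair_ring S T) R"
    and "\<And>s t. s \<in> carrier S \<Longrightarrow> t \<in> carrier T \<Longrightarrow> h (frag_of (s, t)) = u s \<otimes> v t"
proof -
  interpret S: cring S by fact
  interpret T: cring T by fact
  let ?P = "free_pair_ring S T" and ?S = "carrier S \<times> carrier T"
  interpret P: cring ?P using cring_free_pair_ring assms(1,2) .
  have uv: "(\<lambda>(s, t). u s \<otimes> v t) ` ?S \<subseteq> carrier R"
    using ring_hom_closed[OF u] ring_hom_closed[OF v] by auto
  obtain h where h: "h \<in> hom (free_Abelian_group ?S) (add_monoid R)"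
      and h_of': "\<And>x. x \<in> ?S \<Longrightarrow> h (frag_of x) = (\<lambda>(s, t). u s \<otimes> v t) x"
    by (rule add.free_Abelian_group_universal[OF uv]) (rule that)
  have h_of: "h (frag_of (s, t)) = u s \<otimes> v t" if "s \<in> carrier S" "t \<in> carrier T" for s t
    using h_of'[of "(s, t)"] that by simp
  interpret h: group_hom "free_Abelian_group ?S" "add_monoid R" h
    using h by (simp add: group_hom_def group_hom_axioms_def add.is_group)
  have h_closed: "h x \<in> carrier R" if "Poly_Mapping.keys x \<subseteq> ?S" for x
    using h.hom_closed[of x] that by simp
  have h_add: "h (x + y) = h x \<oplus> h y"
    if "Poly_Mapping.keys x \<subseteq> ?S" "Poly_Mapping.keys y \<subseteq> ?S" for x y
    using h.hom_mult[of x y] that by simp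
  have h_0: "h 0 = \<zero>" using h.hom_one by simp
  have h_diff: "h (x - y) = h x \<ominus> h y"
    if x: "Poly_Mapping.keys x \<subseteq> ?S" and y: "Poly_Mapping.keys y \<subseteq> ?S" for x y
  proof -
    have d: "Poly_Mapping.keys (x - y) \<subseteq> ?S" using keys_diff[of x y] that by blast
    have "h x = h (x - y) \<oplus> h y" using h_add[OF d y] by simp
    then show ?thesis using h_closed[OF d] h_closed[OF x] h_closed[OF y]
      by (simp add: a_minus_def a_assoc r_neg)
  qed
  have mult_keys: "Poly_Mapping.keys (x \<otimes>\<^bsub>?P\<^esub> y) \<subseteq> ?S"
    if "Poly_Mapping.keys x \<subseteq> ?S" "Poly_Mapping.keys y \<subseteq> ?S" for x y
    using P.m_closed[of x y] that by (simp add: free_pair_ring_simps)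
  have h_mult: "h (x \<otimes>\<^bsub>?P\<^esub> y) = h x \<otimes> h y"
    if x: "Poly_Mapping.keys x \<subseteq> ?S" and y: "Poly_Mapping.keys y \<subseteq> ?S" for x y
    using x
  proof (induction x rule: free_Abelian_group_diff_induct)
    case zero
    then show ?case using h_closed[OF y] by (simp add: free_pair_ring_mult_zero h_0)
  next
    case (diff x x')
    then show ?case
      using h_closed y mult_keys
      by (simp add: free_pair_ring_mult_diff h_diff a_minus_def l_distr l_minus)
  next
    case (frag_of a)
    from y show ?case
    proof (induction y rule: free_Abelian_group_diff_induct)
      case zero
      then show ?case using h_closed[of "frag_of a"] frag_of by (simp add: free_pair_ring_mult_zero h_0)
    next
      case (diff y y')
      have "Poly_Mapping.keys (frag_of a) \<subseteq> ?S" using frag_of by simp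
      then show ?case using diff h_closed mult_keys
        by (simp add: free_pair_ring_mult_diff h_diff a_minus_def r_distr r_minus)
    next
      case (frag_of b)
      then show ?case using \<open>a \<in> _\<close> ring_hom_closed[OF u] ring_hom_closed[OF v]
        ring_hom_mult[OF u] ring_hom_mult[OF v]
        by (cases a, cases b) (simp add: free_pair_ring_mult_frag_of h_of m_ac)
    qed
  qed
  have "h \<in> ring_hom ?P R"
    using h_closed h_add h_mult ring_hom_one[OF u] ring_hom_one[OF v]
    by (intro ring_hom_memI) (simp_all add: free_pair_ring_simps h_of)
  then show ?thesis using that h_of by blast
qed

text \<open>The kernel of \<open>h\<close> is an ideal that contains the relations, hence the ideal
  they generate. The map is stated on the pair ring instead of on the quotient, so no coset
  representatives have to be chosen.\<close>

lemma (in cring) tensor_ring_universal: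
  assumes S: "cring S" and T: "cring T" and u: "u \<in> ring_hom S R" and v: "v \<in> ring_hom T R"
    and \<alpha>: "\<And>k. k \<in> carrier K \<Longrightarrow> \<alpha> k \<in> carrier S"
    and \<beta>: "\<And>k. k \<in> carrier K \<Longrightarrow> \<beta> k \<in> carrier T"
    and compat: "\<And>k. k \<in> carrier K \<Longrightarrow> u (\<alpha> k) = v (\<beta> k)"
  obtains h where "h \<in> ring_hom (free_pair_ring S T) R"
    and "\<And>s t. s \<in> carrier S \<Longrightarrow> t \<in> carrier T \<Longrightarrow> h (frag_of (s, t)) = u s \<otimes> v t"
    and "\<And>x. x \<in> tensor_ideal K S \<alpha> T \<beta> \<Longrightarrow> h x = \<zero>"
proof -
  interpret S: cring S by fact
  interpret T: cring T by fact
  let ?P = "free_pair_ring S T"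
  interpret P: cring ?P using cring_free_pair_ring S T .
  obtain h where h: "h \<in> ring_hom ?P R"
    and h_of: "\<And>s t. s \<in> carrier S \<Longrightarrow> t \<in> carrier T \<Longrightarrow> h (frag_of (s, t)) = u s \<otimes> v t"
    by (rule free_pair_ring_universal[OF S T u v]) (rule that)
  interpret h: ring_hom_ring ?P R h
    using h by (intro ring_hom_ringI2) unfold_locales
  have ofc: "frag_of (s, t) \<in> carrier ?P" if "s \<in> carrier S" "t \<in> carrier T" for s t
    using that by (simp add: free_pair_ring_simps)
  note uv = ring_hom_closed[OF u] ring_hom_closed[OF v] ring_hom_mult[OF u] ring_hom_mult[OF v]
    ring_hom_add[OF u] ring_hom_add[OF v]
  have h_diff: "h (x - y) = h x \<ominus> h y" "x - y \<in> carrier ?P"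
    if "x \<in> carrier ?P" "y \<in> carrier ?P" for x y
    using free_pair_ring_minus[OF S T that, symmetric] that by (simp_all add: a_minus_def)
  \<comment> \<open>Both kinds of bilinearity relation are mapped to an expression of this
    shape.\<close>
  have canc: "a \<oplus> b \<ominus> a \<ominus> b = \<zero>" if "a \<in> carrier R" "b \<in> carrier R" for a b
    using that by algebra
  have "x \<in> a_kernel ?P R h" if "x \<in> tensor_relations K S \<alpha> T \<beta>" for x
    using that unfolding tensor_relations_def a_kernel_def'
    by (auto simp: h_diff ofc h_of \<alpha> \<beta> uv l_distr r_distr canc m_ac compat[symmetric])
  then have "tensor_ideal K S \<alpha> T \<beta> \<subseteq> a_kernel ?P R h"
    unfolding tensor_ideal_def by (intro P.genideal_minimal h.kernel_is_ideal) blast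
  then show ?thesis using that[OF h h_of] h.kernel_zero by blast
qed


section \<open>The fiber ring as a quotient of the whole ring\<close>

context cring
begin

context
  fixes D \<mm> :: "'a set"
  assumes D: "subring D R" and \<mm>: "ideal \<mm> (R\<lparr>carrier := D\<rparr>)"
begin

lemma subring_of_cring: "cring (R\<lparr>carrier := D\<rparr>)"
  using subcring_iff subringE(1)[OF D] subcringI'[OF D] by blast

lemma subring_quot_cring: "cring (R\<lparr>carrier := D\<rparr> Quot \<mm>)"
  using ideal.quotient_is_cring[OF \<mm> subring_of_cring] .

lemma subring_rcos_hom: "(\<lambda>d. \<mm> +>\<^bsub>R\<lparr>carrier := D\<rparr>\<^esub> d) \<in> ring_hom (R\<lparr>carrier := D\<rparr>) (R\<lparr>carrier := D\<rparr> Quot \<mm>)"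
  using ideal.rcos_ring_hom[OF \<mm>] .

lemma subring_quot_elem:
  "t \<in> carrier (R\<lparr>carrier := D\<rparr> Quot \<mm>) \<Longrightarrow> \<exists>d\<in>D. t = \<mm> +>\<^bsub>R\<lparr>carrier := D\<rparr>\<^esub> d"
  by (simp add: FactRing_def A_RCOSETS_def')

abbreviation fiber_relations :: "(('a \<times> 'a set) \<Rightarrow>\<^sub>0 int) set" where
  "fiber_relations \<equiv> tensor_relations (R\<lparr>carrier := D\<rparr>) R (\<lambda>d. d)
     (R\<lparr>carrier := D\<rparr> Quot \<mm>) (\<lambda>d. \<mm> +>\<^bsub>R\<lparr>carrier := D\<rparr>\<^esub> d)"

abbreviation fiber_tensor_ideal :: "(('a \<times> 'a set) \<Rightarrow>\<^sub>0 int) set" where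
  "fiber_tensor_ideal \<equiv> tensor_ideal (R\<lparr>carrier := D\<rparr>) R (\<lambda>d. d)
     (R\<lparr>carrier := D\<rparr> Quot \<mm>) (\<lambda>d. \<mm> +>\<^bsub>R\<lparr>carrier := D\<rparr>\<^esub> d)"

abbreviation fiber_pair_ring :: "(('a \<times> 'a set) \<Rightarrow>\<^sub>0 int) ring" where
  "fiber_pair_ring \<equiv> free_pair_ring R (R\<lparr>carrier := D\<rparr> Quot \<mm>)"

lemma fiber_relations_carrier: "fiber_relations \<subseteq> carrier fiber_pair_ring"
  by (rule tensor_relations_carrier[OF cring_axioms subring_quot_cring])
    (use subringE(1)[OF D] ring_hom_closed[OF subring_rcos_hom] in auto)

lemma fiber_pair_ring_cring: "cring fiber_pair_ring"
  by (rule cring_free_pair_ring[OF cring_axioms subring_quot_cring])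

lemma ideal_fiber_tensor_ideal: "ideal fiber_tensor_ideal fiber_pair_ring"
  unfolding tensor_ideal_def
  by (rule ring.genideal_ideal[OF cring.axioms(1)[OF fiber_pair_ring_cring] fiber_relations_carrier])

lemma fiber_relations_in_ideal: "fiber_relations \<subseteq> fiber_tensor_ideal"
  unfolding tensor_ideal_def
  by (rule ring.genideal_self[OF cring.axioms(1)[OF fiber_pair_ring_cring] fiber_relations_carrier])

lemma cring_fiber_ring: "cring (fiber_ring R D \<mm>)"
  unfolding fiber_ring_def tensor_ring_def
  by (rule ideal.quotient_is_cring[OF ideal_fiber_tensor_ideal fiber_pair_ring_cring])

lemma ring_hom_fiber_proj:
  "ring_hom_ring fiber_pair_ring (fiber_ring R D \<mm>) (\<lambda>x. fiber_tensor_ideal +>\<^bsub>fiber_pair_ring\<^esub> x)"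
  unfolding fiber_ring_def tensor_ring_def
  by (rule ideal.rcos_ring_hom_ring[OF ideal_fiber_tensor_ideal])

lemma fiber_proj_eq:
  assumes "x - y \<in> fiber_tensor_ideal" "x \<in> carrier fiber_pair_ring" "y \<in> carrier fiber_pair_ring"
  shows "fiber_tensor_ideal +>\<^bsub>fiber_pair_ring\<^esub> x = fiber_tensor_ideal +>\<^bsub>fiber_pair_ring\<^esub> y"
  using assms ring.quotient_eq_iff_same_a_r_cos[OF cring.axioms(1)[OF fiber_pair_ring_cring]
      ideal_fiber_tensor_ideal, of x y]
    free_pair_ring_minus[OF cring_axioms subring_quot_cring] by simp

lemma fiber_map_eq:
  "fiber_map R D \<mm> a = fiber_tensor_ideal +>\<^bsub>fiber_pair_ring\<^esub> frag_of (a, \<one>\<^bsub>R\<lparr>carrier := D\<rparr> Quot \<mm>\<^esub>)"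
  by (simp add: fiber_map_def pure_tensor_def)

lemma frag_of_fiber_carrier:
  "a \<in> carrier R \<Longrightarrow> t \<in> carrier (R\<lparr>carrier := D\<rparr> Quot \<mm>) \<Longrightarrow> frag_of (a, t) \<in> carrier fiber_pair_ring"
  by (simp add: free_pair_ring_simps)

text \<open>Products and the unit are respected already in the pair ring; only additivity needs the
  relations.\<close>

lemma ring_hom_fiber_map: "ring_hom_ring R (fiber_ring R D \<mm>) (fiber_map R D \<mm>)"
proof -
  interpret T: cring "R\<lparr>carrier := D\<rparr> Quot \<mm>" by (rule subring_quot_cring)
  interpret P: cring fiber_pair_ring by (rule fiber_pair_ring_cring)
  interpret B: cring "fiber_ring R D \<mm>" by (rule cring_fiber_ring)
  interpret \<pi>: ring_hom_ring fiber_pair_ring "fiber_ring R D \<mm>"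
    "\<lambda>x. fiber_tensor_ideal +>\<^bsub>fiber_pair_ring\<^esub> x"
    by (rule ring_hom_fiber_proj)
  note fc = frag_of_fiber_carrier[OF _ T.one_closed]
  show ?thesis
  proof (rule ring_hom_ringI[OF ring_axioms B.ring_axioms])
    fix x assume x: "x \<in> carrier R"
    show "fiber_map R D \<mm> x \<in> carrier (fiber_ring R D \<mm>)"
      unfolding fiber_map_eq by (rule \<pi>.hom_closed[OF fc[OF x]])
  next
    fix x y assume x: "x \<in> carrier R" and y: "y \<in> carrier R"
    show "fiber_map R D \<mm> (x \<otimes> y) = fiber_map R D \<mm> x \<otimes>\<^bsub>fiber_ring R D \<mm>\<^esub> fiber_map R D \<mm> y"
      unfolding fiber_map_eq \<pi>.hom_mult[OF fc[OF x] fc[OF y], symmetric] free_pair_ring_mult_frag_of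
      by simp
    have "frag_of (x \<oplus> y, \<one>\<^bsub>R\<lparr>carrier := D\<rparr> Quot \<mm>\<^esub>) - frag_of (x, \<one>\<^bsub>R\<lparr>carrier := D\<rparr> Quot \<mm>\<^esub>)
        - frag_of (y, \<one>\<^bsub>R\<lparr>carrier := D\<rparr> Quot \<mm>\<^esub>) \<in> fiber_relations"
      unfolding tensor_relations_def using x y T.one_closed by blast
    then have "frag_of (x \<oplus> y, \<one>\<^bsub>R\<lparr>carrier := D\<rparr> Quot \<mm>\<^esub>) - (frag_of (x, \<one>\<^bsub>R\<lparr>carrier := D\<rparr> Quot \<mm>\<^esub>)
        + frag_of (y, \<one>\<^bsub>R\<lparr>carrier := D\<rparr> Quot \<mm>\<^esub>)) \<in> fiber_tensor_ideal"
      using fiber_relations_in_ideal by (auto simp: diff_diff_eq)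
    then have "fiber_map R D \<mm> (x \<oplus> y) = fiber_tensor_ideal +>\<^bsub>fiber_pair_ring\<^esub>
        (frag_of (x, \<one>\<^bsub>R\<lparr>carrier := D\<rparr> Quot \<mm>\<^esub>) \<oplus>\<^bsub>fiber_pair_ring\<^esub>
         frag_of (y, \<one>\<^bsub>R\<lparr>carrier := D\<rparr> Quot \<mm>\<^esub>))"
      unfolding fiber_map_eq using fc[OF a_closed[OF x y]] P.a_closed[OF fc[OF x] fc[OF y]]
      by (intro fiber_proj_eq) (simp_all add: free_pair_ring_simps(4))
    then show "fiber_map R D \<mm> (x \<oplus> y) = fiber_map R D \<mm> x \<oplus>\<^bsub>fiber_ring R D \<mm>\<^esub> fiber_map R D \<mm> y"
      unfolding fiber_map_eq \<pi>.hom_add[OF fc[OF x] fc[OF y]] .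
  next
    show "fiber_map R D \<mm> \<one> = \<one>\<^bsub>fiber_ring R D \<mm>\<^esub>"
      using \<pi>.hom_one unfolding fiber_map_eq free_pair_ring_simps .
  qed
qed

text \<open>The scalar \<open>d\<close> moves across the tensor sign, by the balancing relation with
  second component 1.\<close>

lemma fiber_proj_eq_fiber_map:
  assumes a: "a \<in> carrier R" and d: "d \<in> D"
  shows "fiber_tensor_ideal +>\<^bsub>fiber_pair_ring\<^esub> frag_of (a, \<mm> +>\<^bsub>R\<lparr>carrier := D\<rparr>\<^esub> d) = fiber_map R D \<mm> (d \<otimes> a)"
proof -
  interpret T: cring "R\<lparr>carrier := D\<rparr> Quot \<mm>" by (rule subring_quot_cring)
  have dc: "d \<in> carrier R" using d subringE(1)[OF D] by blast
  have dt: "\<mm> +>\<^bsub>R\<lparr>carrier := D\<rparr>\<^esub> d \<in> carrier (R\<lparr>carrier := D\<rparr> Quot \<mm>)"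
    using ring_hom_closed[OF subring_rcos_hom] d by simp
  have "frag_of (d \<otimes> a, \<one>\<^bsub>R\<lparr>carrier := D\<rparr> Quot \<mm>\<^esub>) - frag_of (a, (\<mm> +>\<^bsub>R\<lparr>carrier := D\<rparr>\<^esub> d)
      \<otimes>\<^bsub>R\<lparr>carrier := D\<rparr> Quot \<mm>\<^esub> \<one>\<^bsub>R\<lparr>carrier := D\<rparr> Quot \<mm>\<^esub>) \<in> fiber_relations"
    unfolding tensor_relations_def using a d T.one_closed by auto
  then have "frag_of (d \<otimes> a, \<one>\<^bsub>R\<lparr>carrier := D\<rparr> Quot \<mm>\<^esub>) - frag_of (a, \<mm> +>\<^bsub>R\<lparr>carrier := D\<rparr>\<^esub> d)
      \<in> fiber_tensor_ideal"
    using fiber_relations_in_ideal dt by auto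
  then show ?thesis
    unfolding fiber_map_eq
    by (rule fiber_proj_eq[symmetric]) (use a dc dt frag_of_fiber_carrier in auto)
qed

text \<open>Every element of \<open>D/\<mm>\<close> has a representative in \<open>D\<close>, which
  can be moved to the left factor. So all pure tensors are in the image, and the image is closed
  under differences.\<close>

lemma fiber_map_surj: "fiber_map R D \<mm> ` carrier R = carrier (fiber_ring R D \<mm>)"
proof -
  interpret P: cring fiber_pair_ring by (rule fiber_pair_ring_cring)
  interpret B: cring "fiber_ring R D \<mm>" by (rule cring_fiber_ring)
  interpret \<pi>: ring_hom_ring fiber_pair_ring "fiber_ring R D \<mm>"
    "\<lambda>x. fiber_tensor_ideal +>\<^bsub>fiber_pair_ring\<^esub> x"
    by (rule ring_hom_fiber_proj)
  interpret \<phi>: ring_hom_ring R "fiber_ring R D \<mm>" "fiber_map R D \<mm>"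
    by (rule ring_hom_fiber_map)
  have "fiber_tensor_ideal +>\<^bsub>fiber_pair_ring\<^esub> x \<in> fiber_map R D \<mm> ` carrier R"
    if "Poly_Mapping.keys x \<subseteq> carrier R \<times> carrier (R\<lparr>carrier := D\<rparr> Quot \<mm>)" for x
  proof (rule free_Abelian_group_induct[OF that])
    have "fiber_tensor_ideal +>\<^bsub>fiber_pair_ring\<^esub> 0 = fiber_map R D \<mm> \<zero>"
      using \<pi>.hom_zero \<phi>.hom_zero by (simp add: free_pair_ring_simps)
    then show "fiber_tensor_ideal +>\<^bsub>fiber_pair_ring\<^esub> 0 \<in> fiber_map R D \<mm> ` carrier R" by blast
  next
    fix x y assume "Poly_Mapping.keys x \<subseteq> carrier R \<times> carrier (R\<lparr>carrier := D\<rparr> Quot \<mm>)"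
      and "Poly_Mapping.keys y \<subseteq> carrier R \<times> carrier (R\<lparr>carrier := D\<rparr> Quot \<mm>)"
      and im: "fiber_tensor_ideal +>\<^bsub>fiber_pair_ring\<^esub> x \<in> fiber_map R D \<mm> ` carrier R"
        "fiber_tensor_ideal +>\<^bsub>fiber_pair_ring\<^esub> y \<in> fiber_map R D \<mm> ` carrier R"
    then have xy: "x \<in> carrier fiber_pair_ring" "y \<in> carrier fiber_pair_ring"
      by (simp_all add: free_pair_ring_simps)
    from im obtain a b where ab: "a \<in> carrier R" "b \<in> carrier R"
      "fiber_tensor_ideal +>\<^bsub>fiber_pair_ring\<^esub> x = fiber_map R D \<mm> a"
      "fiber_tensor_ideal +>\<^bsub>fiber_pair_ring\<^esub> y = fiber_map R D \<mm> b" by blast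
    have "fiber_tensor_ideal +>\<^bsub>fiber_pair_ring\<^esub> (x - y) = fiber_map R D \<mm> (a \<ominus> b)"
      unfolding free_pair_ring_minus[OF cring_axioms subring_quot_cring xy, symmetric] a_minus_def
      using ab xy by simp
    then show "fiber_tensor_ideal +>\<^bsub>fiber_pair_ring\<^esub> (x - y) \<in> fiber_map R D \<mm> ` carrier R"
      using ab by blast
  next
    fix p assume "p \<in> carrier R \<times> carrier (R\<lparr>carrier := D\<rparr> Quot \<mm>)"
    then obtain r t where p: "p = (r, t)" "r \<in> carrier R" "t \<in> carrier (R\<lparr>carrier := D\<rparr> Quot \<mm>)"
      by blast
    then obtain d where d: "d \<in> D" "t = \<mm> +>\<^bsub>R\<lparr>carrier := D\<rparr>\<^esub> d"
      using subring_quot_elem by blast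
    have "d \<otimes> r \<in> carrier R" using d(1) p(2) subringE(1)[OF D] by blast
    then show "fiber_tensor_ideal +>\<^bsub>fiber_pair_ring\<^esub> frag_of p \<in> fiber_map R D \<mm> ` carrier R"
      using fiber_proj_eq_fiber_map[OF p(2) d(1)] unfolding p(1) d(2) by blast
  qed
  then have "(\<lambda>x. fiber_tensor_ideal +>\<^bsub>fiber_pair_ring\<^esub> x) ` carrier fiber_pair_ring
      \<subseteq> fiber_map R D \<mm> ` carrier R"
    by (intro image_subsetI) (simp only: free_pair_ring_simps mem_Collect_eq)
  moreover have "carrier (fiber_ring R D \<mm>) = (\<lambda>x. fiber_tensor_ideal +>\<^bsub>fiber_pair_ring\<^esub> x) ` carrier fiber_pair_ring"
    by (auto simp: fiber_ring_def tensor_ring_def FactRing_def A_RCOSETS_def')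
  moreover have "fiber_map R D \<mm> ` carrier R \<subseteq> carrier (fiber_ring R D \<mm>)"
    using \<phi>.hom_closed by (rule image_subsetI)
  ultimately show ?thesis by (simp only: subset_antisym)
qed

text \<open>Moving \<open>d\<close> to the right factor turns it into the zero class of
  \<open>D/\<mm>\<close>.\<close>

lemma fiber_map_eq_zero:
  assumes d: "d \<in> \<mm>" shows "fiber_map R D \<mm> d = \<zero>\<^bsub>fiber_ring R D \<mm>\<^esub>"
proof -
  interpret \<mm>: ideal \<mm> "R\<lparr>carrier := D\<rparr>" by (rule \<mm>)
  interpret T: cring "R\<lparr>carrier := D\<rparr> Quot \<mm>" by (rule subring_quot_cring)
  interpret P: cring fiber_pair_ring by (rule fiber_pair_ring_cring)
  interpret \<pi>: ring_hom_ring fiber_pair_ring "fiber_ring R D \<mm>"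
    "\<lambda>x. fiber_tensor_ideal +>\<^bsub>fiber_pair_ring\<^esub> x"
    by (rule ring_hom_fiber_proj)
  let ?z = "\<zero>\<^bsub>R\<lparr>carrier := D\<rparr> Quot \<mm>\<^esub>"
  have dD: "d \<in> D" using \<mm>.Icarr[OF d] by simp
  have "\<mm> +>\<^bsub>R\<lparr>carrier := D\<rparr>\<^esub> d = ?z"
    using \<mm>.a_rcos_const[OF d] by (simp add: FactRing_def)
  moreover have "d \<otimes> \<one> = d" using dD subringE(1)[OF D] by (simp add: subset_iff)
  ultimately have eq: "fiber_map R D \<mm> d = fiber_tensor_ideal +>\<^bsub>fiber_pair_ring\<^esub> frag_of (\<one>, ?z)"
    using fiber_proj_eq_fiber_map[OF one_closed dD] by simp
  \<comment> \<open>Additivity applied to \<open>0 + 0\<close> in the second factor gives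
    \<open>1 \<otimes> 0 = 0\<close>.\<close>
  have "frag_of (\<one>, ?z \<oplus>\<^bsub>R\<lparr>carrier := D\<rparr> Quot \<mm>\<^esub> ?z) - frag_of (\<one>, ?z) - frag_of (\<one>, ?z) \<in> fiber_relations"
    unfolding tensor_relations_def using T.zero_closed by blast
  then have "0 - frag_of (\<one>, ?z) \<in> fiber_tensor_ideal"
    using fiber_relations_in_ideal by auto
  then have "fiber_tensor_ideal +>\<^bsub>fiber_pair_ring\<^esub> 0 = fiber_tensor_ideal +>\<^bsub>fiber_pair_ring\<^esub> frag_of (\<one>, ?z)"
    using frag_of_fiber_carrier[OF one_closed T.zero_closed] P.zero_closed
    by (intro fiber_proj_eq) (simp_all add: free_pair_ring_simps)
  then show ?thesis using eq \<pi>.hom_zero unfolding free_pair_ring_simps by simp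
qed

text \<open>The projections of \<open>R\<close> and of \<open>D/\<mm>\<close> to \<open>R/Q\<close>
  agree on \<open>D\<close>, so they induce a map from the tensor product that sends
  \<open>a \<otimes> 1\<close> to the class of \<open>a\<close>. With \<open>Q\<close> the extension
  of \<open>\<mm>\<close>, this bounds the kernel by that extension.\<close>

lemma fiber_map_kernel:
  assumes Q: "ideal Q R" and "\<mm> \<subseteq> Q" and a: "a \<in> carrier R"
    and zero: "fiber_map R D \<mm> a = \<zero>\<^bsub>fiber_ring R D \<mm>\<^esub>"
  shows "a \<in> Q"
proof -
  interpret Q: ideal Q R by fact
  interpret \<mm>: ideal \<mm> "R\<lparr>carrier := D\<rparr>" by (rule \<mm>)
  interpret D: cring "R\<lparr>carrier := D\<rparr>" by (rule subring_of_cring)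
  interpret T: cring "R\<lparr>carrier := D\<rparr> Quot \<mm>" by (rule subring_quot_cring)
  interpret P: cring fiber_pair_ring by (rule fiber_pair_ring_cring)
  interpret X: cring "R Quot Q" using Q.quotient_is_cring[OF cring_axioms] .
  interpret q: ring_hom_ring R "R Quot Q" "\<lambda>x. Q +> x" by (rule Q.rcos_ring_hom_ring)
  have DR: "d \<in> carrier R" if "d \<in> D" for d using that subringE(1)[OF D] by blast
  \<comment> \<open>The induced map from \<open>D/\<mm>\<close> to \<open>R/Q\<close> is defined by
    a chosen representative. The choice does not matter, because representatives differ by elements
    of \<open>\<mm>\<close>, which lie in \<open>Q\<close>.\<close>
  define v where "v t = Q +> (SOME d. d \<in> t)" for t
  have v: "v (\<mm> +>\<^bsub>R\<lparr>carrier := D\<rparr>\<^esub> d) = Q +> d" if d: "d \<in> D" for d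
  proof -
    have "d \<in> \<mm> +>\<^bsub>R\<lparr>carrier := D\<rparr>\<^esub> d" using \<mm>.a_rcos_self d by simp
    then have "(SOME e. e \<in> \<mm> +>\<^bsub>R\<lparr>carrier := D\<rparr>\<^esub> d) \<in> \<mm> +>\<^bsub>R\<lparr>carrier := D\<rparr>\<^esub> d" by (rule someI)
    then obtain m where m: "m \<in> \<mm>" "(SOME e. e \<in> \<mm> +>\<^bsub>R\<lparr>carrier := D\<rparr>\<^esub> d) = m \<oplus> d"
      by (auto simp: a_r_coset_def r_coset_def)
    have mQ: "m \<in> Q" "m \<in> carrier R" using m(1) \<open>\<mm> \<subseteq> Q\<close> Q.Icarr by auto
    have "Q +> m = \<zero>\<^bsub>R Quot Q\<^esub>" unfolding Q.a_rcos_const[OF mQ(1)] zero_FactRing ..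
    then have "Q +> (m \<oplus> d) = Q +> d"
      using q.hom_add[OF mQ(2) DR[OF d]] X.l_zero[OF q.hom_closed[OF DR[OF d]]] by simp
    then show ?thesis unfolding v_def m(2) .
  qed
  have v_hom: "v \<in> ring_hom (R\<lparr>carrier := D\<rparr> Quot \<mm>) (R Quot Q)"
  proof (rule ring_hom_memI)
    have ex: "\<exists>d\<in>D. t = \<mm> +>\<^bsub>R\<lparr>carrier := D\<rparr>\<^esub> d" if "t \<in> carrier (R\<lparr>carrier := D\<rparr> Quot \<mm>)" for t
      using subring_quot_elem[OF that] .
    note rc = subring_rcos_hom
    show "v t \<in> carrier (R Quot Q)" if "t \<in> carrier (R\<lparr>carrier := D\<rparr> Quot \<mm>)" for t
      using ex[OF that] v q.hom_closed DR by auto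
    fix s t assume "s \<in> carrier (R\<lparr>carrier := D\<rparr> Quot \<mm>)" "t \<in> carrier (R\<lparr>carrier := D\<rparr> Quot \<mm>)"
    then obtain d e where *: "d \<in> D" "e \<in> D" "s = \<mm> +>\<^bsub>R\<lparr>carrier := D\<rparr>\<^esub> d" "t = \<mm> +>\<^bsub>R\<lparr>carrier := D\<rparr>\<^esub> e"
      using ex by meson
    show "v (s \<otimes>\<^bsub>R\<lparr>carrier := D\<rparr> Quot \<mm>\<^esub> t) = v s \<otimes>\<^bsub>R Quot Q\<^esub> v t"
      using ring_hom_mult[OF rc, of d e] * v[of d] v[of e] v[of "d \<otimes> e"] subringE(6)[OF D] DR by simp
    show "v (s \<oplus>\<^bsub>R\<lparr>carrier := D\<rparr> Quot \<mm>\<^esub> t) = v s \<oplus>\<^bsub>R Quot Q\<^esub> v t"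
      using ring_hom_add[OF rc, of d e] * v[of d] v[of e] v[of "d \<oplus> e"] subringE(7)[OF D] DR by simp
  next
    show "v \<one>\<^bsub>R\<lparr>carrier := D\<rparr> Quot \<mm>\<^esub> = \<one>\<^bsub>R Quot Q\<^esub>"
      using ring_hom_one[OF subring_rcos_hom] v[OF subringE(3)[OF D]] q.hom_one by simp
  qed
  obtain h where h: "h \<in> ring_hom fiber_pair_ring (R Quot Q)"
    and h_of: "\<And>s t. s \<in> carrier R \<Longrightarrow> t \<in> carrier (R\<lparr>carrier := D\<rparr> Quot \<mm>) \<Longrightarrow>
      h (frag_of (s, t)) = (Q +> s) \<otimes>\<^bsub>R Quot Q\<^esub> v t"
    and h_0: "\<And>x. x \<in> fiber_tensor_ideal \<Longrightarrow> h x = \<zero>\<^bsub>R Quot Q\<^esub>"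
    by (rule X.tensor_ring_universal[OF cring_axioms subring_quot_cring Q.rcos_ring_hom v_hom,
          of "R\<lparr>carrier := D\<rparr>" "\<lambda>d. d" "\<lambda>d. \<mm> +>\<^bsub>R\<lparr>carrier := D\<rparr>\<^esub> d"])
      (use DR v ring_hom_closed[OF subring_rcos_hom] in auto)
  have fa: "frag_of (a, \<one>\<^bsub>R\<lparr>carrier := D\<rparr> Quot \<mm>\<^esub>) \<in> carrier fiber_pair_ring"
    by (rule frag_of_fiber_carrier[OF a T.one_closed])
  have "fiber_tensor_ideal +>\<^bsub>fiber_pair_ring\<^esub> frag_of (a, \<one>\<^bsub>R\<lparr>carrier := D\<rparr> Quot \<mm>\<^esub>) = fiber_tensor_ideal"
    using zero unfolding fiber_map_eq by (simp add: fiber_ring_def tensor_ring_def FactRing_def)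
  then have "frag_of (a, \<one>\<^bsub>R\<lparr>carrier := D\<rparr> Quot \<mm>\<^esub>) \<in> fiber_tensor_ideal"
    using ideal.rcos_const_imp_mem[OF ideal_fiber_tensor_ideal fa] by blast
  then have "Q +> a = \<zero>\<^bsub>R Quot Q\<^esub>"
    using h_0 h_of[OF a T.one_closed] ring_hom_one[OF v_hom] X.r_one[OF q.hom_closed[OF a]] by simp
  then have "Q +> a = Q" unfolding zero_FactRing .
  then show ?thesis using Q.rcos_const_imp_mem[OF a] by blast
qed

end

end


section \<open>Tight closure in the fibers\<close>

text \<open>Since \<open>P\<close> contains the kernel, it is the full preimage of its image.
  Statements about the image can then be checked on preimages in \<open>R\<close>, where
  \<open>P\<close> is prime.\<close>

lemma (in ring_hom_ring) primeideal_image: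
  assumes "cring S" and surj: "h ` carrier R = carrier S" and P: "primeideal P R"
    and ker: "\<And>a. a \<in> carrier R \<Longrightarrow> h a = \<zero>\<^bsub>S\<^esub> \<Longrightarrow> a \<in> P"
  shows "primeideal (h ` P) S" and "\<And>a. a \<in> carrier R \<Longrightarrow> h a \<in> h ` P \<Longrightarrow> a \<in> P"
proof -
  interpret P: primeideal P R by (rule P)
  show mem: "a \<in> P" if a: "a \<in> carrier R" and ha: "h a \<in> h ` P" for a
  proof -
    obtain b where b: "b \<in> P" "h a = h b" using ha by blast
    have bc: "b \<in> carrier R" by (rule P.Icarr[OF b(1)])
    have "h (a \<ominus> b) = \<zero>\<^bsub>S\<^esub>" using a bc b(2) by (simp add: a_minus_def S.r_neg)
    then have "a \<ominus> b \<in> P" using a bc by (intro ker) simp_all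
    then have "(a \<ominus> b) \<oplus> b \<in> P" using b(1) by (rule P.a_closed)
    moreover have "(a \<ominus> b) \<oplus> b = a" using a bc by (simp add: a_minus_def R.a_assoc R.l_neg)
    ultimately show ?thesis by simp
  qed
  have ex: "\<exists>x\<in>carrier R. y = h x" if "y \<in> carrier S" for y
    using that surj by blast
  show "primeideal (h ` P) S"
  proof (rule primeidealI[OF idealI[OF S.ring_axioms] assms(1)])
    show "subgroup (h ` P) (add_monoid S)" by (rule img_is_add_subgroup[OF P.a_subgroup])
  next
    fix a x assume "a \<in> h ` P" and x: "x \<in> carrier S"
    then obtain p r where *: "p \<in> P" "a = h p" "r \<in> carrier R" "x = h r" using ex by blast
    have pc: "p \<in> carrier R" by (rule P.Icarr[OF *(1)])
    have "x \<otimes>\<^bsub>S\<^esub> a = h (r \<otimes> p)" "a \<otimes>\<^bsub>S\<^esub> x = h (p \<otimes> r)" using * pc by simp_all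
    then show "x \<otimes>\<^bsub>S\<^esub> a \<in> h ` P" "a \<otimes>\<^bsub>S\<^esub> x \<in> h ` P"
      using P.I_l_closed[OF *(1,3)] P.I_r_closed[OF *(1,3)] by blast+
  next
    show "carrier S \<noteq> h ` P"
    proof
      assume "carrier S = h ` P"
      then have "carrier R \<subseteq> P" using mem hom_closed by blast
      then show False using P.I_notcarr P.Icarr by blast
    qed
  next
    fix a b assume "a \<in> carrier S" "b \<in> carrier S" and ab: "a \<otimes>\<^bsub>S\<^esub> b \<in> h ` P"
    then obtain x y where *: "x \<in> carrier R" "y \<in> carrier R" "a = h x" "b = h y" using ex by meson
    have "x \<otimes> y \<in> P" using ab * by (intro mem) simp_all
    then show "a \<in> h ` P \<or> b \<in> h ` P" using P.I_prime[OF *(1,2)] *(3,4) by blast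
  qed
qed

text \<open>The elements whose image lies in the target Frobenius power form an ideal, and this
  ideal contains the \<open>q\<close>-th powers of the elements of \<open>J\<close>.\<close>

lemma (in ring_hom_ring) frobenius_power_image:
  assumes J: "J \<subseteq> carrier R" and x: "x \<in> frobenius_power R J q"
  shows "h x \<in> frobenius_power S (extended_ideal S h J) q"
proof -
  let ?E = "extended_ideal S h J" and ?F = "frobenius_power S (extended_ideal S h J) q"
  have hJ: "h ` J \<subseteq> carrier S" using J hom_closed by blast
  have EI: "ideal ?E S" unfolding extended_ideal_def by (rule S.genideal_ideal[OF hJ])
  have pow: "{x [^]\<^bsub>S\<^esub> q | x. x \<in> ?E} \<subseteq> carrier S"
    using ideal.Icarr[OF EI] by auto
  have "ideal ?F S" unfolding frobenius_power_def by (rule S.genideal_ideal[OF pow])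
  then have "ideal {r \<in> carrier R. h r \<in> ?F} R" by (rule ideal_vimage)
  moreover have "{x [^] q | x. x \<in> J} \<subseteq> {r \<in> carrier R. h r \<in> ?F}"
  proof clarify
    fix y assume y: "y \<in> J"
    then have "h y \<in> ?E" unfolding extended_ideal_def using S.genideal_self[OF hJ] by blast
    then have "h y [^]\<^bsub>S\<^esub> q \<in> ?F" unfolding frobenius_power_def using S.genideal_self[OF pow] by blast
    moreover have "y \<in> carrier R" using y J by blast
    ultimately show "y [^] q \<in> carrier R \<and> h (y [^] q) \<in> ?F" by (simp add: hom_nat_pow)
  qed
  ultimately have "frobenius_power R J q \<subseteq> {r \<in> carrier R. h r \<in> ?F}"
    unfolding frobenius_power_def[of R] by (rule R.genideal_minimal)
  then show ?thesis using x by blast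
qed

text \<open>The unit undoes the factor \<open>s\<close>: multiplying the image of
  \<open>c (s f)^q\<close> by \<open>u^q\<close> leaves the image of \<open>c f^q\<close>, so
  \<open>h c\<close> is a witness.\<close>

lemma (in ring_hom_ring) tight_closure_image:
  assumes "cring R" "cring S" and J: "J \<subseteq> carrier R"
    and c: "c \<in> carrier R" and min: "\<And>P. minimal_prime P S \<Longrightarrow> h c \<notin> P"
    and pow: "\<And>e. e \<ge> e0 \<Longrightarrow> c \<otimes> (s \<otimes> f) [^] (p ^ e) \<in> frobenius_power R J (p ^ e)"
    and f: "f \<in> carrier R" and s: "s \<in> carrier R" and u: "u \<in> carrier S" "u \<otimes>\<^bsub>S\<^esub> h s = \<one>\<^bsub>S\<^esub>"
  shows "h f \<in> tight_closure p S (extended_ideal S h J)"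
proof -
  interpret R: cring R by fact
  interpret S: cring S by fact
  let ?E = "extended_ideal S h J"
  have hJ: "h ` J \<subseteq> carrier S" using J hom_closed by blast
  have EI: "ideal ?E S" unfolding extended_ideal_def by (rule S.genideal_ideal[OF hJ])
  have FI: "ideal (frobenius_power S ?E q) S" for q
    unfolding frobenius_power_def by (rule S.genideal_ideal) (use ideal.Icarr[OF EI] in auto)
  have "h c \<otimes>\<^bsub>S\<^esub> h f [^]\<^bsub>S\<^esub> (p ^ e) \<in> frobenius_power S ?E (p ^ e)" if "e \<ge> e0" for e
  proof -
    let ?q = "p ^ e"
    have "h (c \<otimes> (s \<otimes> f) [^] ?q) \<in> frobenius_power S ?E ?q"
      by (rule frobenius_power_image[OF J pow[OF that]])
    then have "u [^]\<^bsub>S\<^esub> ?q \<otimes>\<^bsub>S\<^esub> (h c \<otimes>\<^bsub>S\<^esub> (h s \<otimes>\<^bsub>S\<^esub> h f) [^]\<^bsub>S\<^esub> ?q) \<in> frobenius_power S ?E ?q"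
      using c s f u ideal.I_l_closed[OF FI] by (simp add: hom_nat_pow)
    moreover have "u [^]\<^bsub>S\<^esub> ?q \<otimes>\<^bsub>S\<^esub> (h c \<otimes>\<^bsub>S\<^esub> (h s \<otimes>\<^bsub>S\<^esub> h f) [^]\<^bsub>S\<^esub> ?q)
        = h c \<otimes>\<^bsub>S\<^esub> ((u \<otimes>\<^bsub>S\<^esub> h s) [^]\<^bsub>S\<^esub> ?q \<otimes>\<^bsub>S\<^esub> h f [^]\<^bsub>S\<^esub> ?q)"
      using c s f u(1) by (simp add: S.nat_pow_distrib S.m_ac)
    ultimately show ?thesis using u(2) f by simp
  qed
  then show ?thesis
    unfolding tight_closure_def using f c min hom_closed by blast
qed

section \<open>Clearing denominators and avoiding the minimal primes of a fiber\<close>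

text \<open>In an equation \<open>f/1 = h/s\<close> the auxiliary factor \<open>t\<close> from
  \<open>S\<close> is nonzero and cancels, which leaves \<open>s f = h\<close>.\<close>

lemma (in domain) loc_frac_in_loc_idealD:
  assumes S: "S \<subseteq> carrier R - {\<zero>}" "\<one> \<in> S" and J: "J \<subseteq> carrier R" and f: "f \<in> carrier R"
    and mem: "loc_frac R S f \<one> \<in> loc_ideal R S J"
  obtains s where "s \<in> S" "s \<otimes> f \<in> J"
proof -
  from mem obtain h s where hs: "h \<in> J" "s \<in> S" "loc_frac R S f \<one> = loc_frac R S h s"
    unfolding loc_ideal_def by blast
  \<comment> \<open>Equality of fractions is read off from membership of this representative in the
    other class, so only reflexivity of \<open>loc_rel\<close> is used.\<close>
  have "(f, \<one>) \<in> loc_frac R S f \<one>"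
    unfolding loc_frac_def loc_rel_def using S f by auto
  then have "(f, \<one>) \<in> loc_frac R S h s" using hs(3) by simp
  then obtain t where t: "t \<in> S" "t \<otimes> (\<one> \<otimes> h) = t \<otimes> (s \<otimes> f)"
    unfolding loc_frac_def loc_rel_def by blast
  have "h \<in> carrier R" "s \<in> carrier R" "t \<in> carrier R" "t \<noteq> \<zero>" using hs t S J by auto
  then have "h = s \<otimes> f" using t(2) f m_lcancel[of t h "s \<otimes> f"] by simp
  then show ?thesis using that hs by blast
qed

text \<open>The ideal \<open>M + (d)\<close> contains \<open>d\<close> and so strictly contains
  \<open>M\<close>; by maximality it is the whole ring.\<close>

lemma (in cring) maximalideal_coprime:
  assumes M: "maximalideal M R" and d: "d \<in> carrier R" "d \<notin> M"
  obtains a r where "a \<in> M" "r \<in> carrier R" "a \<oplus> r \<otimes> d = \<one>"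
proof -
  interpret M: maximalideal M R by (rule M)
  have PI: "ideal (PIdl d) R" by (rule cgenideal_ideal[OF d(1)])
  have sum: "ideal (M <+>\<^bsub>R\<^esub> PIdl d) R" by (rule add_ideals[OF M.is_ideal PI])
  have zero: "\<zero> \<in> PIdl d" by (rule additive_subgroup.zero_closed[OF ideal.axioms(1)[OF PI]])
  have "m \<in> M <+>\<^bsub>R\<^esub> PIdl d" if m: "m \<in> M" for m
  proof -
    have "m \<oplus> \<zero> \<in> M <+>\<^bsub>R\<^esub> PIdl d" unfolding set_add_def' using m zero by blast
    then show ?thesis using M.Icarr[OF m] by simp
  qed
  then have sub: "M \<subseteq> M <+>\<^bsub>R\<^esub> PIdl d" by blast
  have "\<zero> \<oplus> d \<in> M <+>\<^bsub>R\<^esub> PIdl d"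
    unfolding set_add_def' using M.zero_closed cgenideal_self[OF d(1)] by blast
  then have "M <+>\<^bsub>R\<^esub> PIdl d \<noteq> M" using d by auto
  then have "M <+>\<^bsub>R\<^esub> PIdl d = carrier R"
    using M.I_maximal[OF sum sub] ideal.Icarr[OF sum] by blast
  then have "\<one> \<in> M <+>\<^bsub>R\<^esub> PIdl d" by simp
  then obtain a b where ab: "a \<in> M" "b \<in> PIdl d" "\<one> = a \<oplus> b" unfolding set_add_def' by blast
  from ab(2) obtain r where "r \<in> carrier R" "b = r \<otimes> d" unfolding cgenideal_def by blast
  then show ?thesis using that ab by auto
qed

text \<open>If \<open>c x = y \<pi>\<close>, then \<open>\<pi>\<close> multiplies \<open>y\<close>
  into \<open>(c)\<close>, hence so does \<open>d\<close>, say \<open>d y = z c\<close>. Cancelling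
  \<open>c\<close> in \<open>c d x = z c \<pi>\<close> gives \<open>d x = z \<pi>\<close>, and
  \<open>d\<close> is invertible modulo \<open>\<pi>\<close>.\<close>

lemma (in domain) nonzerodivisor_mod_uniformizer:
  assumes c: "c \<in> carrier R" "c \<noteq> \<zero>" and \<pi>: "\<pi> \<in> carrier R" and d: "d \<in> carrier R"
    and unif: "\<And>y. y \<in> carrier R \<Longrightarrow> \<pi> \<otimes> y \<in> PIdl c \<Longrightarrow> d \<otimes> y \<in> PIdl c"
    and one: "u \<in> carrier R" "r \<in> carrier R" "u \<otimes> \<pi> \<oplus> r \<otimes> d = \<one>"
    and x: "x \<in> carrier R" "c \<otimes> x \<in> PIdl \<pi>"
  shows "x \<in> PIdl \<pi>"
proof -
  obtain y where y: "y \<in> carrier R" "c \<otimes> x = y \<otimes> \<pi>" using x(2) unfolding cgenideal_def by blast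
  have "\<pi> \<otimes> y = x \<otimes> c" using y x c \<pi> by (metis m_comm)
  then have "d \<otimes> y \<in> PIdl c" using unif[OF y(1)] x(1) unfolding cgenideal_def by blast
  then obtain z where z: "z \<in> carrier R" "d \<otimes> y = z \<otimes> c" unfolding cgenideal_def by blast
  have "c \<otimes> (d \<otimes> x) = d \<otimes> (c \<otimes> x)" using c d x by (simp add: m_ac)
  also have "\<dots> = (d \<otimes> y) \<otimes> \<pi>" unfolding y(2) using d y \<pi> by (simp add: m_ac)
  also have "\<dots> = c \<otimes> (z \<otimes> \<pi>)" unfolding z(2) using z c \<pi> by (simp add: m_ac)
  finally have dx: "d \<otimes> x = z \<otimes> \<pi>" using m_lcancel[of c] c d x z \<pi> by simp
  have "x = (u \<otimes> \<pi> \<oplus> r \<otimes> d) \<otimes> x" using one x by simp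
  also have "\<dots> = u \<otimes> x \<otimes> \<pi> \<oplus> r \<otimes> (d \<otimes> x)" using one(1,2) \<pi> d x(1) by algebra
  also have "\<dots> = (u \<otimes> x \<oplus> r \<otimes> z) \<otimes> \<pi>" unfolding dx using one(1,2) \<pi> x(1) z(1) by algebra
  finally show ?thesis unfolding cgenideal_def using one(1,2) x(1) z(1) by blast
qed

lemma (in domain) fiber_map_notin_minimal_prime:
  assumes noeth: "noetherian_ring R" and D: "subring D R"
    and dim: "krull_dim (R\<lparr>carrier := D\<rparr>) = 1" and \<mm>: "maximalideal \<mm> (R\<lparr>carrier := D\<rparr>)"
    and c: "c \<in> carrier R" "c \<noteq> \<zero>" and d: "d \<in> D" "d \<notin> \<mm>"
    and unif: "\<And>e y. e \<in> D - {\<zero>} \<Longrightarrow> y \<in> carrier R \<Longrightarrow> e \<otimes> y \<in> PIdl c \<Longrightarrow> d \<otimes> y \<in> PIdl c"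
    and P: "minimal_prime P (fiber_ring R D \<mm>)"
  shows "fiber_map R D \<mm> c \<notin> P"
proof
  assume cP: "fiber_map R D \<mm> c \<in> P"
  interpret D: domain "R\<lparr>carrier := D\<rparr>" by (rule subring_is_domain[OF D])
  interpret \<mm>: maximalideal \<mm> "R\<lparr>carrier := D\<rparr>" by (rule \<mm>)
  let ?B = "fiber_ring R D \<mm>" and ?\<phi> = "fiber_map R D \<mm>"
  interpret \<phi>: ring_hom_ring R ?B ?\<phi> by (rule ring_hom_fiber_map[OF D \<mm>.is_ideal])
  have B: "cring ?B" by (rule cring_fiber_ring[OF D \<mm>.is_ideal])
  have DR: "x \<in> carrier R" if "x \<in> D" for x using that subringE(1)[OF D] by blast
  have \<mm>D: "x \<in> D" if "x \<in> \<mm>" for x using \<mm>.Icarr[OF that] by simp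
  have Pp: "primeideal P ?B" and Pmin: "\<And>Q. primeideal Q ?B \<Longrightarrow> Q \<subseteq> P \<Longrightarrow> Q = P"
    using P unfolding minimal_prime_def by blast+
  have P0: "\<zero>\<^bsub>?B\<^esub> \<in> P"
    by (rule additive_subgroup.zero_closed[OF ideal.axioms(1)[OF primeideal.axioms(1)[OF Pp]]])
  define Q where "Q = {r \<in> carrier R. ?\<phi> r \<in> P}"
  have Q: "primeideal Q R"
    unfolding Q_def by (rule \<phi>.primeideal_vimage[OF is_cring Pp])
  have \<mm>Q: "\<mm> \<subseteq> Q"
    unfolding Q_def using fiber_map_eq_zero[OF D \<mm>.is_ideal] P0 \<mm>D DR by auto
  obtain a r where ar: "a \<in> \<mm>" "r \<in> D" "a \<oplus> r \<otimes> d = \<one>"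
    using D.maximalideal_coprime[OF \<mm>, of d] d by auto
  have "\<mm> \<noteq> {\<zero>}"
    using D.maximal_ideal_nonzero_if_krull_dim_1[OF dim \<mm>] by simp
  moreover have "\<zero> \<in> \<mm>" using \<mm>.zero_closed by simp
  ultimately obtain b where b: "b \<in> \<mm>" "b \<noteq> \<zero>" by blast
  \<comment> \<open>A nonzero \<open>\<pi>\<close> is required, both for \<open>unif\<close> and for
    a nonzero contraction below. If \<open>a = 0\<close>, then \<open>d\<close> is already a unit,
    and the nonzero \<open>b\<close> is taken with \<open>u = 0\<close>.\<close>
  have "\<exists>\<pi>\<in>\<mm>. \<pi> \<noteq> \<zero> \<and> (\<exists>u\<in>carrier R. u \<otimes> \<pi> = a)"
  proof (cases "a = \<zero>")
    case True
    then show ?thesis using b DR[OF \<mm>D] by (intro bexI[of _ b]) (auto intro!: bexI[of _ \<zero>])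
  next
    case False
    then show ?thesis using ar(1) DR[OF \<mm>D] by (intro bexI[of _ a]) (auto intro!: bexI[of _ \<one>])
  qed
  then obtain \<pi> u where \<pi>: "\<pi> \<in> \<mm>" "\<pi> \<noteq> \<zero>" "u \<in> carrier R" "u \<otimes> \<pi> = a" by blast
  have \<pi>R: "\<pi> \<in> carrier R" by (rule DR[OF \<mm>D[OF \<pi>(1)]])
  have one: "u \<otimes> \<pi> \<oplus> r \<otimes> d = \<one>" unfolding \<pi>(4) by (rule ar(3))
  have unif': "d \<otimes> y \<in> PIdl c" if "y \<in> carrier R" "\<pi> \<otimes> y \<in> PIdl c" for y
    using unif[OF _ that] \<mm>D[OF \<pi>(1)] \<pi>(2) by simp
  have sub: "PIdl \<pi> \<subseteq> Q"
    by (rule cgenideal_minimal[OF primeideal.axioms(1)[OF Q]]) (use \<mm>Q \<pi>(1) in blast)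
  obtain P' where P': "primeideal P' R" "PIdl \<pi> \<subseteq> P'" "P' \<subseteq> Q" "c \<notin> P'"
    using exists_prime_avoiding_nonzerodivisor[OF noeth c(1) Q cgenideal_ideal[OF \<pi>R] sub
        nonzerodivisor_mod_uniformizer[OF c \<pi>R DR[OF d(1)] unif' \<pi>(3) DR[OF ar(2)] one]]
    by blast
  interpret incl: ring_hom_ring "R\<lparr>carrier := D\<rparr>" R "\<lambda>x. x"
    by (rule ring_hom_ringI[OF D.ring_axioms ring_axioms]) (use DR in auto)
  have contr: "primeideal {x \<in> D. x \<in> I} (R\<lparr>carrier := D\<rparr>)" if "primeideal I R" for I
    using incl.primeideal_vimage[OF D.is_cring that] by simp
  have \<pi>P': "\<pi> \<in> P'" using P'(2) cgenideal_self[OF \<pi>R] by blast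
  \<comment> \<open>Both contractions are primes of \<open>D\<close>, and the smaller one contains
    \<open>\<pi>\<close>. Dimension one makes them equal, which carries \<open>\<mm>\<close> from
    \<open>Q\<close> down to \<open>P'\<close>.\<close>
  have "{x \<in> D. x \<in> P'} = {x \<in> D. x \<in> Q}"
  proof (rule D.nonzero_prime_maximal_if_krull_dim_1[OF dim contr[OF P'(1)] _ contr[OF Q]])
    show "{x \<in> D. x \<in> P'} \<noteq> {\<zero>\<^bsub>R\<lparr>carrier := D\<rparr>\<^esub>}"
      using \<pi>P' \<pi>(2) \<mm>D[OF \<pi>(1)] by auto
    show "{x \<in> D. x \<in> P'} \<subseteq> {x \<in> D. x \<in> Q}" using P'(3) by blast
  qed
  then have "\<mm> \<subseteq> P'" using \<mm>Q \<mm>D by blast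
  \<comment> \<open>The image of \<open>P'\<close> is prime because \<open>P'\<close> contains the
    kernel of the fiber map, which follows from \<open>\<mm> \<subseteq> P'\<close>.\<close>
  then have ker: "x \<in> P'" if "x \<in> carrier R" "?\<phi> x = \<zero>\<^bsub>?B\<^esub>" for x
    using fiber_map_kernel[OF D \<mm>.is_ideal primeideal.axioms(1)[OF P'(1)] _ that] by blast
  note img = \<phi>.primeideal_image[OF B fiber_map_surj[OF D \<mm>.is_ideal] P'(1) ker]
  have "?\<phi> ` P' \<subseteq> P" using P'(3) unfolding Q_def by blast
  \<comment> \<open>Minimality of \<open>P\<close> forces equality; since \<open>P'\<close> is
    saturated, the image of \<open>c\<close> lying in \<open>P\<close> would put \<open>c\<close> in
    \<open>P'\<close>.\<close>
  then have "?\<phi> ` P' = P" using Pmin img(1) by blast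
  then have "c \<in> P'" using img(2)[OF _ _ c(1)] cP by blast
  then show False using P'(4) by blast
qed

theorem proposition1p1:
  fixes A :: "('a, 'm) ring_scheme" and F D S I :: "'a set" and f :: 'a and p :: nat
  assumes "domain A"
    and "subring D A"
    and "subfield F A" and "F \<subseteq> D"
    and "p = ring_char (subring_of A F)" and "p > 0"
    and "finite_type A F"
    and "finite_type (subring_of A D) F"
    and "krull_dim (subring_of A D) = 1"
    and "ideal I A" and "f \<in> carrier A"
    and "S = D - {\<zero>\<^bsub>A\<^esub>}"
    and "loc_frac A S f \<one>\<^bsub>A\<^esub> \<in> tight_closure p (localization A S) (loc_ideal A S I)"
    and "tight_closure p (localization A S) (loc_ideal A S I)
           = loc_ideal A S (tight_closure p A I)"
  shows "finite {\<mm>. maximalideal \<mm> (subring_of A D) \<and>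
           fiber_map A D \<mm> f \<notin> tight_closure p (fiber_ring A D \<mm>)
             (extended_ideal (fiber_ring A D \<mm>) (fiber_map A D \<mm>) I)}"
proof -
  interpret domain A by fact
  note D = \<open>subring D A\<close> and F = \<open>subfield F A\<close> and S = \<open>S = D - {\<zero>\<^bsub>A\<^esub>}\<close> and f = \<open>f \<in> carrier A\<close>
    and dim = \<open>krull_dim (subring_of A D) = 1\<close>
  interpret D: domain "subring_of A D" by (rule subring_is_domain[OF D])
  have DR: "x \<in> carrier A" if "x \<in> D" for x using that subringE(1)[OF D] by blast
  have noeth: "noetherian_ring A"
    by (rule finite_type_over_subfield_imp_noetherian[OF F \<open>finite_type A F\<close>])
  have "field (subring_of A F)" by (rule subfield_iff(2)[OF F])
  then have "subfield F (subring_of A D)"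
    using \<open>F \<subseteq> D\<close> by (intro D.subfield_iff(1)) simp_all
  then have D_noeth: "noetherian_ring (subring_of A D)"
    using D.finite_type_over_subfield_imp_noetherian \<open>finite_type (subring_of A D) F\<close> by blast
  have S_sub: "S \<subseteq> carrier A - {\<zero>\<^bsub>A\<^esub>}" "\<one>\<^bsub>A\<^esub> \<in> S"
    using S DR subringE(3)[OF D] by auto
  \<comment> \<open>The assumed commutation with localization moves the problem from the generic
    fiber to \<open>A\<close>, where one witness \<open>c\<close> will serve almost all
    fibers.\<close>
  have "loc_frac A S f \<one>\<^bsub>A\<^esub> \<in> loc_ideal A S (tight_closure p A I)"
    using assms(13) unfolding assms(14) .
  then obtain s where s: "s \<in> S" "s \<otimes>\<^bsub>A\<^esub> f \<in> tight_closure p A I"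
    using loc_frac_in_loc_idealD[OF S_sub _ f, of "tight_closure p A I"]
    unfolding tight_closure_def by blast
  then obtain c e0 where c: "c \<in> carrier A" and c_min: "\<And>P. minimal_prime P A \<Longrightarrow> c \<notin> P"
    and pow: "\<And>e. e \<ge> e0 \<Longrightarrow>
      c \<otimes>\<^bsub>A\<^esub> (s \<otimes>\<^bsub>A\<^esub> f) [^]\<^bsub>A\<^esub> (p ^ e) \<in> frobenius_power A I (p ^ e)"
    unfolding tight_closure_def by blast
  \<comment> \<open>In a domain the zero ideal is a minimal prime, so the condition on the witness
    says that \<open>c\<close> is nonzero.\<close>
  have "minimal_prime {\<zero>\<^bsub>A\<^esub>} A"
    unfolding minimal_prime_def using zeroprimeideal
    by (auto dest!: primeideal.axioms(1) ideal.axioms(1) additive_subgroup.zero_closed)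
  then have c0: "c \<noteq> \<zero>\<^bsub>A\<^esub>" using c_min by blast
  have "submonoid S A"
    using S_sub S subringE(6)[OF D] DR by unfold_locales (auto simp: integral_iff)
  then obtain d where d: "d \<in> S" and unif: "\<And>e x. e \<in> S \<Longrightarrow> x \<in> carrier A \<Longrightarrow>
      e \<otimes>\<^bsub>A\<^esub> x \<in> PIdl\<^bsub>A\<^esub> c \<Longrightarrow> d \<otimes>\<^bsub>A\<^esub> x \<in> PIdl\<^bsub>A\<^esub> c"
    using exists_uniform_denominator[OF noeth cgenideal_ideal[OF c]] by blast
  have sd: "s \<in> D" "d \<in> D" "s \<noteq> \<zero>\<^bsub>A\<^esub>" "d \<noteq> \<zero>\<^bsub>A\<^esub>" using s d S by auto
  \<comment> \<open>The exceptional maximal ideals all contain this product: outside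
    \<open>g\<close> neither \<open>s\<close> nor \<open>d\<close> lies in \<open>\<mm>\<close>, so
    \<open>s\<close> becomes invertible and \<open>d\<close> can serve as the uniform
    denominator.\<close>
  define g where "g = s \<otimes>\<^bsub>A\<^esub> d"
  have g: "g \<in> D" "g \<noteq> \<zero>\<^bsub>A\<^esub>"
    unfolding g_def using sd subringE(6)[OF D] DR by (auto simp: integral_iff)
  have "fiber_map A D \<mm> f \<in> tight_closure p (fiber_ring A D \<mm>)
      (extended_ideal (fiber_ring A D \<mm>) (fiber_map A D \<mm>) I)"
    if \<mm>: "maximalideal \<mm> (subring_of A D)" and "g \<notin> \<mm>" for \<mm>
  proof -
    interpret \<mm>: maximalideal \<mm> "subring_of A D" by (rule \<mm>)
    interpret \<phi>: ring_hom_ring A "fiber_ring A D \<mm>" "fiber_map A D \<mm>"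
      by (rule ring_hom_fiber_map[OF D \<mm>.is_ideal])
    have "s \<notin> \<mm>" "d \<notin> \<mm>"
      using \<open>g \<notin> \<mm>\<close> \<mm>.I_l_closed[of d s] \<mm>.I_r_closed[of s d] sd unfolding g_def by auto
    \<comment> \<open>The fiber map kills \<open>a\<close>, so the image of \<open>u\<close> is the
      inverse of the image of \<open>s\<close>.\<close>
    obtain a u where au: "a \<in> \<mm>" "u \<in> D" "a \<oplus>\<^bsub>A\<^esub> u \<otimes>\<^bsub>A\<^esub> s = \<one>\<^bsub>A\<^esub>"
      using D.maximalideal_coprime[OF \<mm>, of s] \<open>s \<notin> \<mm>\<close> sd by auto
    have aR: "a \<in> carrier A" using \<mm>.Icarr[OF au(1)] DR by simp
    have "fiber_map A D \<mm> u \<otimes>\<^bsub>fiber_ring A D \<mm>\<^esub> fiber_map A D \<mm> s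
        = \<zero>\<^bsub>fiber_ring A D \<mm>\<^esub> \<oplus>\<^bsub>fiber_ring A D \<mm>\<^esub> fiber_map A D \<mm> (u \<otimes>\<^bsub>A\<^esub> s)"
      using DR[OF au(2)] DR[OF sd(1)] by simp
    also have "\<dots> = fiber_map A D \<mm> (a \<oplus>\<^bsub>A\<^esub> u \<otimes>\<^bsub>A\<^esub> s)"
      using DR[OF au(2)] DR[OF sd(1)] aR
      by (simp add: fiber_map_eq_zero[OF D \<mm>.is_ideal au(1)])
    also have "\<dots> = \<one>\<^bsub>fiber_ring A D \<mm>\<^esub>" unfolding au(3) by simp
    finally have unit: "fiber_map A D \<mm> u \<otimes>\<^bsub>fiber_ring A D \<mm>\<^esub> fiber_map A D \<mm> s = \<one>\<^bsub>fiber_ring A D \<mm>\<^esub>" .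
    have I: "I \<subseteq> carrier A" using ideal.Icarr[OF \<open>ideal I A\<close>] by blast
    have "fiber_map A D \<mm> c \<notin> P" if "minimal_prime P (fiber_ring A D \<mm>)" for P
      by (rule fiber_map_notin_minimal_prime[OF noeth D dim \<mm> c c0 sd(2) \<open>d \<notin> \<mm>\<close> unif that])
        (use S in auto)
    then show ?thesis
      using \<phi>.tight_closure_image[OF is_cring cring_fiber_ring[OF D \<mm>.is_ideal] I c _ pow f
          DR[OF sd(1)] \<phi>.hom_closed[OF DR[OF au(2)]] unit] by blast
  qed
  then have "{\<mm>. maximalideal \<mm> (subring_of A D) \<and>
      fiber_map A D \<mm> f \<notin> tight_closure p (fiber_ring A D \<mm>)
        (extended_ideal (fiber_ring A D \<mm>) (fiber_map A D \<mm>) I)}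
      \<subseteq> {\<mm>. maximalideal \<mm> (subring_of A D) \<and> g \<in> \<mm>}" by blast
  moreover have "finite {\<mm>. maximalideal \<mm> (subring_of A D) \<and> g \<in> \<mm>}"
    using D.finite_maximal_ideals_containing[OF D_noeth dim, of g] g by simp
  ultimately show ?thesis by (rule finite_subset)
qed

end
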